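(* Let $\ell$ be a fixed positive integer. Then $$\#\{n\le x: T^{(\ell)}(n)=n\}=o(x)\qquad(x\to\infty),$$ where $n$ ranges over positive integers for which $T^{(\ell)}(n)$ is defined. In particular, for every fixed $\ell$, the set of periodic points of $T$ of exact period $\ell$ has asymptotic density zero.
   Context: The Dedekind psi function is $\psi(n)=n\prod_{p\mid n}\left(1+\frac1p\right)$ for positive integers $n$ (product over primes $p$ dividing $n$), and $T(n):=\psi(n)-n$. Put $T^{(0)}(n)=n$ and $T^{(j+1)}(n)=T\bigl(T^{(j)}(n)\bigr)$ whenever $T^{(j)}(n)$ is a positive integer (note $T(1)=0$, so an orbit may terminate at $0$). A positive integer $n$ is a periodic point of $T$ if $T^{(r)}(n)=n$ for some positive integer $r$ for which the relevant iterates are defined; the least such $r$ is the exact period of $n$. The asymptotic density of a set $A$ of positive integers is $d(A)=\lim_{x\to\infty}\frac1x\#\{n\le x:n\in A\}$ when the limit exists. *)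

theory Defs
  imports "HOL-Library.Landau_Symbols" "HOL-Computational_Algebra.Primes"
begin

definition dedekind_psi :: "nat \<Rightarrow> real" where
  "dedekind_psi n = real n * (\<Prod>p\<in>prime_factors n. 1 + 1 / real p)"

text \<open>
  The value \<open>dedekind_psi n - real n\<close> is always a natural number, so the rounding below
  changes nothing; see \<open>of_nat_T\<close>.
\<close>

definition T :: "nat \<Rightarrow> nat" where
  "T n = nat \<lfloor>dedekind_psi n - real n\<rfloor>"

text \<open>The iterate is \<open>None\<close> where it is undefined: \<open>T\<close> is only applied to positive integers.\<close>

fun T_iter :: "nat \<Rightarrow> nat \<Rightarrow> nat option" where
  "T_iter 0 n = Some n"
| "T_iter (Suc j) n =
     (case T_iter j n of
        None \<Rightarrow> None
      | Some m \<Rightarrow> if m > 0 then Some (T m) else None)"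

definition periodic_point :: "nat \<Rightarrow> bool" where
  "periodic_point n \<longleftrightarrow> n > 0 \<and> (\<exists>r>0. T_iter r n = Some n)"

definition exact_period :: "nat \<Rightarrow> nat" where
  "exact_period n = (LEAST r. r > 0 \<and> T_iter r n = Some n)"

definition has_asymptotic_density :: "nat set \<Rightarrow> real \<Rightarrow> bool" where
  "has_asymptotic_density A d \<longleftrightarrow>
     ((\<lambda>x::real. real (card {n. 0 < n \<and> real n \<le> x \<and> n \<in> A}) / x) \<longlongrightarrow> d) at_top"

lemma prod_prime_factors_dvd:
  fixes n :: nat
  assumes "n > 0"
  shows "\<Prod>(prime_factors n) dvd n"
proof -
  have "prod_mset (mset_set (prime_factors n)) dvd prod_mset (prime_factorization n)"
    by (intro prod_mset_subset_imp_dvd mset_set_set_mset_msubset)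
  with assms show ?thesis
    by (simp add: prod_mset_prime_factorization_nat prod_unfold_prod_mset)
qed

lemma dedekind_psi_nat:
  obtains m where "dedekind_psi n = real m" "n \<le> m"
proof (cases "n = 0")
  case True
  then show ?thesis using that[of 0] by (simp add: dedekind_psi_def)
next
  case False
  define P where "P = \<Prod>(prime_factors n)"
  obtain k where k: "n = P * k"
    using prod_prime_factors_dvd[of n] False unfolding P_def by (auto elim: dvdE)
  have pos: "p > 0" if "p \<in> prime_factors n" for p
    using that by (simp add: in_prime_factors_iff prime_gt_0_nat)
  have "real P * (\<Prod>p\<in>prime_factors n. 1 + 1 / real p) = (\<Prod>p\<in>prime_factors n. real p * (1 + 1 / real p))"
    by (simp add: P_def prod.distrib)
  also have "\<dots> = (\<Prod>p\<in>prime_factors n. real (p + 1))"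
    using pos by (intro prod.cong) (auto simp: field_simps)
  finally have "dedekind_psi n = real (k * (\<Prod>p\<in>prime_factors n. p + 1))"
    unfolding dedekind_psi_def by (subst (1) k) (simp add: mult.assoc mult.left_commute)
  moreover have "P \<le> (\<Prod>p\<in>prime_factors n. p + 1)"
    unfolding P_def by (intro prod_mono) auto
  ultimately show ?thesis
    using that[of "k * (\<Prod>p\<in>prime_factors n. p + 1)"] k by (metis mult.commute mult_le_mono1)
qed

lemma of_nat_T: "real (T n) = dedekind_psi n - real n"
proof -
  obtain m where m: "dedekind_psi n = real m" "n \<le> m" by (rule dedekind_psi_nat)
  then have "dedekind_psi n - real n = real (m - n)" by simp
  then show ?thesis unfolding T_def by simp
qed

end

theory Submission
  imports Defs
    "HOL-Number_Theory.Residue_Primitive_Roots"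
    "HOL-Number_Theory.Prime_Powers"
    "HOL-Computational_Algebra.Squarefree"
begin

text \<open>
  Let \<open>m\<close> be the least element of a cycle of length \<open>l\<close>. Then \<open>T m \<ge> m\<close>, that is,
  \<open>\<psi>(m) / m \<ge> 2\<close>. Outside a set of small density, already the primes \<open>p \<le> y\<close> dividing \<open>m\<close>
  push this ratio strictly above 2, because the values \<open>\<psi>(n) / n\<close> do not concentrate near 2.
  Moreover, for almost all \<open>n\<close> the small primes dividing \<open>n\<close> divide all of \<open>T n, \<dots>, T\<^sup>l n\<close>:
  if \<open>q\<close> and \<open>p \<equiv> -1 (mod q)\<close> are primes dividing \<open>n\<close>, then \<open>q\<close> divides \<open>\<psi>(n)\<close> and hence \<open>T n\<close>,
  and such a \<open>p\<close> can be chosen from a fixed finite set for almost all \<open>n\<close>, since the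
  reciprocals of the primes \<open>\<equiv> -1 (mod q)\<close> have a divergent sum. Hence the ratio stays above 2 along the
  whole orbit, the orbit of \<open>m\<close> increases strictly, and it cannot return to \<open>m\<close>. So the cycle minima have
  density zero, and with them all elements of cycles of length \<open>l\<close>. The divergence is
  proved by Shapiro's elementary method for prime moduli.
\<close>

section \<open>Divisor sums and partial summation\<close>

text \<open>Nothing is known about the large prime factors of the iterates, and preimages of sparse
  sets under \<open>T\<close> are never estimated. So every exceptional condition is put on the
  starting point \<open>n\<close>, and later ratios are only bounded below, through the primes up to
  \<open>y\<close> that \<open>n\<close> hands down. The truncated ratio must therefore exceed 2
  strictly, and the \<open>n\<close> with \<open>psi_ratio n \<ge> 2\<close> whose truncated ratio
  is at most 2 have to be shown rare. For most of them the truncated ratio lies in a short interval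
  just below 2, and some prime \<open>p > z\<close> from a fixed finite set divides \<open>n\<close>
  exactly once. Different such \<open>p\<close> move the ratio by clearly different factors, so
  \<open>n div p\<close> determines \<open>n\<close>, and at most \<open>N / z\<close> such
  \<open>n\<close> lie below \<open>N\<close>.

  Only primes \<open>q\<close> have to be handed down, so only the progressions \<open>-1\<close>
  modulo a prime occur. Their unit groups are cyclic, which makes all characters explicit. The
  remaining analytic input is \<open>L(1, \<chi>) \<noteq> 0\<close>, proved by the hyperbola method
  for the quadratic character and by pairing with the conjugate for the others.\<close>

lemma sum_divisors_swap:
  fixes F :: "nat \<Rightarrow> nat \<Rightarrow> 'a::comm_monoid_add"
  shows "(\<Sum>n=1..N. \<Sum>d | d dvd n. F d (n div d)) = (\<Sum>d=1..N. \<Sum>e=1..N div d. F d e)"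
proof -
  have le: "b \<le> N" if "b * k \<le> N" "0 < k" for b k
    using that by (metis One_nat_def Suc_leI le_trans mult.right_neutral mult_le_mono2)
  have "(\<Sum>n=1..N. \<Sum>d | d dvd n. F d (n div d)) =
        (\<Sum>(n,d)\<in>(SIGMA n:{1..N}. {d. d dvd n}). F d (n div d))"
    by (rule sum.Sigma) (auto intro: finite_divisors_nat)
  also have "\<dots> = (\<Sum>(d,e)\<in>(SIGMA d:{1..N}. {1..N div d}). F d e)"
    by (rule sum.reindex_bij_witness[where i = "\<lambda>(d,e). (d * e, d)" and j = "\<lambda>(n,d). (d, n div d)"])
       (auto simp: div_le_mono less_eq_div_iff_mult_less_eq Suc_le_eq mult.commute
             dest: dvd_imp_le intro: Nat.gr0I le elim!: dvdE)
  also have "\<dots> = (\<Sum>d=1..N. \<Sum>e=1..N div d. F d e)"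
    by (rule sum.Sigma [symmetric]) auto
  finally show ?thesis .
qed

text \<open>Every divisor is \<open>p ^ i * d\<close> in exactly one way, since the multiplicity of
  \<open>p\<close> recovers \<open>i\<close>. With \<open>prime_power_decomp\<close> this lets
  divisor sums be evaluated one prime at a time.\<close>

lemma sum_divisors_prime_power_mult:
  fixes f :: "nat \<Rightarrow> 'a::comm_monoid_add"
  assumes p: "prime p" and m: "\<not> p dvd m"
  shows "(\<Sum>d | d dvd p ^ k * m. f d) = (\<Sum>i\<le>k. \<Sum>d | d dvd m. f (p ^ i * d))"
proof -
  have m0: "m > 0" using m by (auto intro: Nat.gr0I)
  have mult: "multiplicity p (p ^ i * d) = i" if "d dvd m" for i d
  proof -
    have "\<not> p dvd d" "d > 0" using that m m0 by (auto dest: dvd_trans intro: Nat.gr0I)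
    then show ?thesis
      using p by (simp add: prime_elem_multiplicity_mult_distrib not_dvd_imp_multiplicity_0)
  qed
  have "(\<Sum>i\<le>k. \<Sum>d | d dvd m. f (p ^ i * d)) =
        (\<Sum>(i,d)\<in>{..k} \<times> {d. d dvd m}. f (p ^ i * d))"
    using m0 by (subst sum.Sigma) (auto simp: finite_divisors_nat)
  also have "\<dots> = (\<Sum>d\<in>(\<lambda>(i,d). p ^ i * d) ` ({..k} \<times> {d. d dvd m}). f d)"
  proof (subst sum.reindex)
    show "inj_on (\<lambda>(i,d). p ^ i * d) ({..k} \<times> {d. d dvd m})"
    proof (rule inj_onI, clarsimp)
      fix i d j e assume *: "d dvd m" "e dvd m" "p ^ i * d = p ^ j * e"
      then have "i = j" by (metis mult)
      with * p show "i = j \<and> d = e" by auto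
    qed
  qed (simp add: case_prod_unfold o_def)
  also have "(\<lambda>(i,d). p ^ i * d) ` ({..k} \<times> {d. d dvd m}) = {d. d dvd p ^ k * m}"
  proof (intro equalityI subsetI)
    fix x assume "x \<in> {d. d dvd p ^ k * m}"
    then obtain a b where "x = a * b" "a dvd p ^ k" "b dvd m"
      using division_decomp by blast
    moreover from this p obtain i where "a = p ^ i" "i \<le> k"
      by (auto simp: divides_primepow_nat)
    ultimately show "x \<in> (\<lambda>(i,d). p ^ i * d) ` ({..k} \<times> {d. d dvd m})"
      by (intro image_eqI[of _ _ "(i, b)"]) auto
  qed (auto intro: mult_dvd_mono le_imp_power_dvd)
  finally show ?thesis ..
qed

lemma prime_power_decomp:
  fixes n :: nat
  assumes "n > 1"
  obtains p k m where "prime p" "k > 0" "\<not> p dvd m" "n = p ^ k * m" "m < n" "m > 0"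
proof -
  obtain p where p: "prime p" "p dvd n" using assms prime_factor_nat[of n] by auto
  obtain m where m: "n = p ^ multiplicity p n * m" "\<not> p dvd m"
    using multiplicity_decompose'[of n p] assms p by (metis not_prime_unit gr_implies_not0)
  have k: "multiplicity p n > 0"
    using p assms by (simp add: prime_multiplicity_gt_zero_iff)
  have m0: "m > 0" using m assms by (auto intro: Nat.gr0I)
  have "1 < p ^ multiplicity p n" using p k prime_gt_1_nat[of p] by (intro one_less_power) auto
  then have "m < n" using m0 by (subst m(1)) simp
  with that p k m m0 show ?thesis by blast
qed

section \<open>The Moebius function\<close>

definition moebius :: "nat \<Rightarrow> 'a::comm_ring_1" where
  "moebius n = (if squarefree n then (- 1) ^ card (prime_factors n) else 0)"

lemma norm_moebius_le: "norm (moebius n :: 'a::{comm_ring_1,real_normed_algebra_1}) \<le> 1"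
  by (auto simp: moebius_def norm_power intro: order_trans[OF norm_power_ineq])

lemma moebius_1 [simp]: "moebius (Suc 0) = 1"
  by (simp add: moebius_def)

lemma moebius_prime_mult:
  assumes "prime p" "\<not> p dvd d"
  shows "moebius (p * d) = - moebius d"
proof -
  have d0: "d > 0" using assms by (auto intro: Nat.gr0I)
  have "coprime p d" using assms by (simp add: prime_imp_coprime)
  then have "squarefree (p * d) \<longleftrightarrow> squarefree d"
    using assms by (meson squarefree_mult_coprime squarefree_multD(2) squarefree_prime)
  moreover have "prime_factors (p * d) = insert p (prime_factors d)"
    using assms d0 by (simp add: prime_factors_product prime_prime_factors)
  moreover have "p \<notin> prime_factors d" using assms by auto
  ultimately show ?thesis by (simp add: moebius_def)
qed

lemma moebius_prime_power_mult: "prime p \<Longrightarrow> moebius (p ^ Suc (Suc i) * d) = 0"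
  unfolding moebius_def squarefree_def
  by (auto simp: power2_eq_square dest!: spec[of _ p] intro: dvd_mult2)

text \<open>After splitting off one prime \<open>p\<close>, exponents from 2 on contribute nothing,
  and the terms for \<open>d\<close> and \<open>p * d\<close> cancel.\<close>

lemma sum_moebius_divisors:
  assumes "n > 0"
  shows "(\<Sum>d | d dvd n. moebius d :: 'a::comm_ring_1) = (if n = 1 then 1 else 0)"
proof (cases "n = 1")
  case False
  then have "n > 1" using assms by simp
  then obtain p k m where *: "prime p" "k > 0" "\<not> p dvd m" "n = p ^ k * m"
    using prime_power_decomp by metis
  then obtain j where j: "k = Suc j" using gr0_conv_Suc by blast
  have "(\<Sum>d | d dvd n. moebius d :: 'a) = (\<Sum>i\<le>k. \<Sum>d | d dvd m. moebius (p ^ i * d))"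
    unfolding \<open>n = _\<close> by (rule sum_divisors_prime_power_mult) fact+
  also have "\<dots> = (\<Sum>i\<in>{0,1}. \<Sum>d | d dvd m. moebius (p ^ i * d))"
  proof (intro sum.mono_neutral_right ballI)
    fix i assume "i \<in> {..k} - {0, 1}"
    then have "i = Suc (Suc (i - 2))" by auto
    then have "moebius (p ^ i * d) = (0::'a)" for d
      using moebius_prime_power_mult[of p "i - 2" d] * by simp
    then show "(\<Sum>d | d dvd m. moebius (p ^ i * d)) = (0::'a)" by simp
  qed (auto simp: j)
  also have "\<dots> = (\<Sum>d | d dvd m. moebius d) + (\<Sum>d | d dvd m. moebius (p * d))" by simp
  also have "(\<Sum>d | d dvd m. moebius (p * d) :: 'a) = (\<Sum>d | d dvd m. - moebius d)"
    using * by (intro sum.cong moebius_prime_mult) (auto dest: dvd_trans)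
  finally show ?thesis using False by (simp add: sum_negf)
qed simp

section \<open>Summation by parts and the Dirichlet test\<close>

lemma abel_summation_bound:
  fixes c :: "nat \<Rightarrow> complex" and w :: "nat \<Rightarrow> real"
  assumes B: "\<And>N. norm (\<Sum>k=1..N. c k) \<le> B"
    and anti: "\<And>k. k > m \<Longrightarrow> w (Suc k) \<le> w k" and nonneg: "\<And>k. k > m \<Longrightarrow> w k \<ge> 0"
  shows "norm (\<Sum>k=Suc m..n. c k * w k) \<le> 2 * B * w (Suc m)"
proof -
  define S where "S N = (\<Sum>k=1..N. c k)" for N
  \<comment> \<open>The interior part of summation by parts: the sum of
    \<open>S k * (w k - w (Suc k))\<close> over \<open>m < k < n\<close>. Its bound telescopes;
    adding the two boundary terms cancels \<open>w n\<close> and leaves the factor 2.\<close>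
  define E where "E n = (\<Sum>k=Suc m..n. c k * w k) - S n * w n + S m * w (Suc m)" for n
  have B0: "B \<ge> 0" using B[of 0] by simp
  have SB: "norm (S N * complex_of_real (w k)) \<le> B * w k" if "k > m" for N k
    using B[of N] nonneg[OF that] by (simp add: S_def norm_mult mult_right_mono)
  have E: "norm (E n) \<le> B * (w (Suc m) - w n)" if "n \<ge> Suc m" for n
    using that
  proof (induction n rule: dec_induct)
    case base
    have "E (Suc m) = 0" by (simp add: E_def S_def algebra_simps)
    then show ?case by simp
  next
    case (step n)
    have "S (Suc n) = S n + c (Suc n)" by (simp add: S_def)
    moreover have "(\<Sum>k=Suc m..Suc n. c k * w k) = (\<Sum>k=Suc m..n. c k * w k) + c (Suc n) * w (Suc n)"
      using step by simp
    ultimately have "E (Suc n) = E n + S n * complex_of_real (w n - w (Suc n))"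
      by (simp add: E_def algebra_simps)
    then have "norm (E (Suc n)) \<le> norm (E n) + norm (S n) * norm (complex_of_real (w n - w (Suc n)))"
      by (metis norm_mult norm_triangle_ineq)
    also have "\<dots> \<le> B * (w (Suc m) - w n) + B * (w n - w (Suc n))"
      using step B[of n] anti[of n] B0 unfolding S_def norm_of_real by (intro add_mono mult_mono) auto
    finally show ?case by (simp add: algebra_simps)
  qed
  show ?thesis
  proof (cases "n \<ge> Suc m")
    case True
    have "(\<Sum>k=Suc m..n. c k * w k) = E n + S n * w n - S m * w (Suc m)"
      by (simp add: E_def)
    then have "norm (\<Sum>k=Suc m..n. c k * w k) \<le> norm (E n) + norm (S n * w n) + norm (S m * w (Suc m))"
      by (metis (no_types) norm_triangle_ineq norm_triangle_ineq4 order_trans add_right_mono)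
    also have "\<dots> \<le> B * (w (Suc m) - w n) + B * w n + B * w (Suc m)"
      using True by (intro add_mono E SB) auto
    finally show ?thesis by (simp add: algebra_simps)
  next
    case False
    then show ?thesis using B0 nonneg[of "Suc m"] by simp
  qed
qed

text \<open>The explicit rate matters because these tail errors are later summed over
  \<open>d\<close>. The offset \<open>m0\<close> admits weights such as \<open>ln k / k\<close> that
  decrease only eventually.\<close>

lemma dirichlet_test_bound:
  fixes c :: "nat \<Rightarrow> complex" and w :: "nat \<Rightarrow> real"
  assumes B: "\<And>N. norm (\<Sum>k=1..N. c k) \<le> B"
    and anti: "\<And>k. k > m0 \<Longrightarrow> w (Suc k) \<le> w k" and nonneg: "\<And>k. k > m0 \<Longrightarrow> w k \<ge> 0"
    and lim: "w \<longlonglongrightarrow> 0"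
  obtains l where "\<And>m. m \<ge> m0 \<Longrightarrow> norm ((\<Sum>k=1..m. c k * w k) - l) \<le> 2 * B * w (Suc m)"
proof -
  define X where "X m = (\<Sum>k=1..m. c k * w k)" for m
  have diff: "norm (X n - X m) \<le> 2 * B * w (Suc m)" if "m \<ge> m0" "n \<ge> m" for m n
  proof -
    have "X n - X m = (\<Sum>k=Suc m..n. c k * w k)"
      unfolding X_def using that sum.ub_add_nat[of 1 m "\<lambda>k. c k * w k" "n - m"] by simp
    then show ?thesis using abel_summation_bound[of c B m w n] assms that by simp
  qed
  have lim': "(\<lambda>m. 2 * B * w (Suc m)) \<longlonglongrightarrow> 0"
    using tendsto_mult_right_zero[OF LIMSEQ_Suc[OF lim]] by simp
  have "Cauchy X"
  proof (rule metric_CauchyI)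
    fix e :: real assume "e > 0"
    then have "eventually (\<lambda>m. 2 * B * w (Suc m) < e / 2) sequentially"
      using lim' by (intro order_tendstoD) auto
    then obtain M where M: "\<And>m. m \<ge> M \<Longrightarrow> 2 * B * w (Suc m) < e / 2"
      by (auto simp: eventually_sequentially)
    define M' where "M' = max M m0"
    have "dist (X n) (X M') < e / 2" if "n \<ge> M'" for n
      using diff[of M' n] M[of M'] that by (simp add: M'_def dist_norm)
    then show "\<exists>M. \<forall>m\<ge>M. \<forall>n\<ge>M. dist (X m) (X n) < e"
      by (metis dist_triangle_half_l)
  qed
  then obtain l where l: "X \<longlonglongrightarrow> l" by (auto simp: Cauchy_convergent_iff convergent_def)
  have "norm (X m - l) \<le> 2 * B * w (Suc m)" if "m \<ge> m0" for m
  proof -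
    have "(\<lambda>n. X n - X m) \<longlonglongrightarrow> l - X m" by (intro tendsto_intros l)
    then have "norm (l - X m) \<le> 2 * B * w (Suc m)"
      by (intro tendsto_upperbound[OF tendsto_norm])
         (auto simp: eventually_sequentially intro!: exI[of _ m] diff that)
    then show ?thesis by (simp add: norm_minus_commute)
  qed
  then show ?thesis using that[of l] unfolding X_def by blast
qed

section \<open>Twisted sums of the von Mangoldt function\<close>

text \<open>Brings logarithmic errors into the form \<open>C / sqrt x\<close>, the one shape that
  \<open>moebius_sum_remainder\<close> handles.\<close>

lemma ln_over_self_le_inverse_sqrt:
  fixes x :: real assumes "x > 0" shows "ln x / x \<le> 2 / sqrt x"
proof -
  have "ln x = 2 * ln (sqrt x)" using assms by (simp add: ln_sqrt)
  also have "\<dots> \<le> 2 * sqrt x" using ln_le_minus_one[of "sqrt x"] assms by simp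
  finally have "ln x / x \<le> 2 * sqrt x / x" using assms by (simp add: divide_right_mono)
  also have "\<dots> = 2 / sqrt x" using assms by (simp add: real_div_sqrt field_simps)
  finally show ?thesis .
qed

lemma sum_inverse_sqrt_le: "(\<Sum>d=1..N. 1 / sqrt (real d)) \<le> 2 * sqrt (real N)"
proof (induction N)
  case (Suc N)
  have "1 / sqrt (real (Suc N)) \<le> 2 * (sqrt (real (Suc N)) - sqrt (real N))"
  proof -
    define a b where "a = sqrt (real (Suc N))" and "b = sqrt (real N)"
    have ab: "a > 0" "b \<ge> 0" "b \<le> a" "a * a - b * b = 1" by (auto simp: a_def b_def)
    have "1 = (a - b) * (a + b)" using ab by (simp add: algebra_simps)
    also have "\<dots> \<le> (a - b) * (2 * a)" using ab by (intro mult_left_mono) auto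
    finally show ?thesis using ab unfolding a_def[symmetric] b_def[symmetric] by (simp add: field_simps)
  qed
  with Suc show ?case by simp
qed simp

text \<open>Moebius inversion of \<open>mangoldt_sum\<close>: after exchanging the sums over pairs
  with \<open>d * e dvd n\<close>, the inner Moebius sum leaves only \<open>e = n\<close>.\<close>

lemma moebius_ln_eq_mangoldt:
  assumes "n > 0"
  shows "(\<Sum>d | d dvd n. moebius d * of_real (ln (real (n div d)))) = (mangoldt n :: complex)"
proof -
  have swap: "(SIGMA d:{d. d dvd n}. {e. e dvd n div d}) = {(d,e). d * e dvd n}"
    using assms by (auto simp: dvd_div_iff_mult mult.commute dest: dvd_mult_left dvd_mult_right)
  have fin: "finite {d. d dvd m}" if "d dvd n" "m = n div d" for d m
    using that assms by (intro finite_divisors_nat) (auto simp: dvd_div_eq_0_iff intro!: Nat.gr0I)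
  have "(\<Sum>d | d dvd n. moebius d * of_real (ln (real (n div d)))) =
        (\<Sum>d | d dvd n. \<Sum>e | e dvd n div d. moebius d * mangoldt e :: complex)"
  proof (intro sum.cong refl)
    fix d assume "d \<in> {d. d dvd n}"
    then have "n div d \<noteq> 0" using assms by (auto simp: dvd_div_eq_0_iff)
    then show "moebius d * of_real (ln (real (n div d))) = (\<Sum>e | e dvd n div d. moebius d * mangoldt e :: complex)"
      by (simp add: mangoldt_sum flip: sum_distrib_left)
  qed
  also have "\<dots> = (\<Sum>(d,e)\<in>{(d,e). d * e dvd n}. moebius d * mangoldt e)"
    using assms fin unfolding swap[symmetric] by (subst sum.Sigma) auto
  also have "\<dots> = (\<Sum>(e,d)\<in>{(d,e). d * e dvd n}. moebius d * mangoldt e)"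
    by (rule sum.reindex_bij_witness[where i = "\<lambda>(a,b). (b,a)" and j = "\<lambda>(a,b). (b,a)"])
       (auto simp: mult.commute)
  also have "\<dots> = (\<Sum>e | e dvd n. \<Sum>d | d dvd n div e. moebius d * mangoldt e)"
    using assms fin unfolding swap[symmetric] by (subst sum.Sigma) auto
  also have "\<dots> = (\<Sum>e | e dvd n. if e = n then mangoldt n else 0)"
  proof (intro sum.cong refl)
    fix e assume e: "e \<in> {e. e dvd n}"
    then have "n div e > 0" using assms by (auto simp: dvd_div_eq_0_iff intro!: Nat.gr0I)
    moreover have "n div e = 1 \<longleftrightarrow> e = n" using e assms by (auto elim!: dvdE)
    ultimately show "(\<Sum>d | d dvd n div e. moebius d * mangoldt e) = (if e = n then mangoldt n else 0 :: complex)"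
      by (simp add: sum_moebius_divisors flip: sum_distrib_right)
  qed
  also have "\<dots> = mangoldt n" using assms by (simp add: finite_divisors_nat)
  finally show ?thesis .
qed

lemma real_divide_le_Suc_div: "d > 0 \<Longrightarrow> real N / real d \<le> real (Suc (N div d))"
  using dividend_less_times_div[of d N]
  by (simp add: divide_le_eq algebra_simps flip: of_nat_mult of_nat_add)

lemma div_remainder_mono:
  assumes "C \<ge> 0" "d \<in> {1..N}"
  shows "C / sqrt (real (Suc (N div d))) \<le> C / sqrt (real N / real d)"
  using assms real_divide_le_Suc_div[of d N]
  by (intro divide_left_mono real_sqrt_le_mono mult_pos_pos) (auto simp del: of_nat_Suc)

text \<open>What the analysis takes from a nonprincipal Dirichlet character: complete
  multiplicativity and bounded partial sums. Periodicity will enter only through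
  \<open>B\<close>.\<close>

locale bounded_character =
  fixes \<chi> :: "nat \<Rightarrow> complex" and B :: real
  assumes chi_1: "\<chi> 1 = 1"
    and chi_mult: "\<chi> (m * n) = \<chi> m * \<chi> n"
    and norm_chi_le: "norm (\<chi> n) \<le> 1"
    and sum_chi_le: "norm (\<Sum>n=1..N. \<chi> n) \<le> B"
begin

text \<open>\<open>L0\<close> is \<open>L(1, \<chi>)\<close>, pinned down by the rate of convergence of its series.\<close>

definition L0 :: complex where
  "L0 = (SOME l. \<forall>m. norm ((\<Sum>k=1..m. \<chi> k * of_real (1 / real k)) - l) \<le> 2 * B / real (Suc m))"

lemma L0_bound: "norm ((\<Sum>k=1..m. \<chi> k * of_real (1 / real k)) - L0) \<le> 2 * B / real (Suc m)"
proof -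
  have "(\<lambda>k. 1 / real k) \<longlonglongrightarrow> 0" by (rule lim_1_over_n)
  then obtain l where "\<And>m. m \<ge> 0 \<Longrightarrow> norm ((\<Sum>k=1..m. \<chi> k * of_real (1 / real k)) - l) \<le> 2 * B * (1 / real (Suc m))"
    using dirichlet_test_bound[of \<chi> B 0 "\<lambda>k. 1 / real k"] sum_chi_le by (auto simp: frac_le)
  then have "\<forall>m. norm ((\<Sum>k=1..m. \<chi> k * of_real (1 / real k)) - l) \<le> 2 * B / real (Suc m)"
    by simp
  then have "\<forall>m. norm ((\<Sum>k=1..m. \<chi> k * of_real (1 / real k)) - L0) \<le> 2 * B / real (Suc m)"
    unfolding L0_def by (rule someI)
  then show ?thesis ..
qed

text \<open>The limit \<open>l\<close> is \<open>- L'(1, \<chi>)\<close>.\<close>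

lemma L1_bound:
  obtains l C where "C \<ge> 0"
    "\<And>m. norm ((\<Sum>k=1..m. \<chi> k * of_real (ln (real k) / real k)) - l) \<le> C / sqrt (real (Suc m))"
proof -
  let ?w = "\<lambda>k. ln (real k) / real k"
  have B0: "B \<ge> 0" using sum_chi_le[of 0] by simp
  \<comment> \<open>The function \<open>ln x / x\<close> decreases only from \<open>exp 1\<close>
    on, hence the threshold 2.\<close>
  have anti: "?w (Suc k) \<le> ?w k" if "k > 2" for k
  proof (rule ln_x_over_x_mono)
    have "3 \<le> real k" using that by linarith
    then show "exp 1 \<le> real k" using exp_le by linarith
  qed auto
  have "?w \<longlonglongrightarrow> 0"
    by (rule filterlim_compose[OF ln_x_over_x_tendsto_0 filterlim_real_sequentially])
  then obtain l where l: "\<And>m. m \<ge> 2 \<Longrightarrow> norm ((\<Sum>k=1..m. \<chi> k * of_real (?w k)) - l) \<le> 2 * B * ?w (Suc m)"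
    using dirichlet_test_bound[of \<chi> B 2 ?w, OF sum_chi_le anti] by force
  define n where "n m = norm ((\<Sum>k=1..m. \<chi> k * of_real (?w k)) - l)" for m
  \<comment> \<open>The term \<open>4 * B\<close> serves \<open>m \<ge> 2\<close>; the other two
    make the bound true for \<open>m = 0\<close> and \<open>m = 1\<close>.\<close>
  define C where "C = 4 * B + n 0 + n 1 * sqrt 2"
  have n0: "n m \<ge> 0" for m by (simp add: n_def)
  have "n m \<le> C / sqrt (real (Suc m))" for m
  proof (cases "m \<ge> 2")
    case True
    have "n m \<le> 2 * B * ?w (Suc m)" using l[OF True] by (simp add: n_def)
    also have "\<dots> \<le> 2 * B * (2 / sqrt (real (Suc m)))"
      using B0 ln_over_self_le_inverse_sqrt[of "real (Suc m)"] by (intro mult_left_mono) auto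
    also have "\<dots> \<le> C / sqrt (real (Suc m))"
      using n0[of 0] n0[of 1] B0 by (simp add: C_def divide_right_mono)
    finally show ?thesis .
  next
    case False
    then consider "m = 0" | "m = 1" by linarith
    then show ?thesis
    proof cases
      case 1
      then show ?thesis using n0[of 1] B0 by (simp add: C_def)
    next
      case 2
      then show ?thesis using n0[of 0] B0 by (simp add: C_def field_simps)
    qed
  qed
  moreover have "C \<ge> 0" using n0[of 0] n0[of 1] B0 by (simp add: C_def)
  ultimately show ?thesis using that[of C l] by (simp add: n_def)
qed

text \<open>Truncation of the series of \<open>1 / L(s, \<chi>)\<close> at
  \<open>s = 1\<close>.\<close>

abbreviation M :: "nat \<Rightarrow> complex" where
  "M N \<equiv> \<Sum>d=1..N. moebius d * \<chi> d / of_nat d"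

text \<open>Truncation of the series of \<open>- L'(s, \<chi>) / L(s, \<chi>)\<close> at
  \<open>s = 1\<close>.\<close>

abbreviation K :: "nat \<Rightarrow> complex" where
  "K N \<equiv> \<Sum>n=1..N. \<chi> n * mangoldt n / of_nat n"

text \<open>Complete multiplicativity splits the term at \<open>n = d * e\<close>. The weights used
  below are \<open>ln e\<close>, \<open>1\<close> and \<open>ln (N / (d * e))\<close>.\<close>

lemma twisted_convolution:
  "(\<Sum>n=1..N. \<chi> n / of_nat n * (\<Sum>d | d dvd n. moebius d * f d (n div d))) =
   (\<Sum>d=1..N. moebius d * \<chi> d / of_nat d * (\<Sum>e=1..N div d. \<chi> e / of_nat e * f d e))"
proof -
  have "(\<Sum>n=1..N. \<chi> n / of_nat n * (\<Sum>d | d dvd n. moebius d * f d (n div d))) =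
        (\<Sum>n=1..N. \<Sum>d | d dvd n. moebius d * \<chi> d / of_nat d * (\<chi> (n div d) / of_nat (n div d) * f d (n div d)))"
    unfolding sum_distrib_left
  proof (intro sum.cong refl)
    fix n d assume "n \<in> {1..N}" "d \<in> {d. d dvd n}"
    then obtain e where e: "n = d * e" "d > 0" by (auto elim!: dvdE intro: Nat.gr0I)
    then show "\<chi> n / of_nat n * (moebius d * f d (n div d)) =
      moebius d * \<chi> d / of_nat d * (\<chi> (n div d) / of_nat (n div d) * f d (n div d))"
      by (simp add: chi_mult)
  qed
  also have "\<dots> = (\<Sum>d=1..N. \<Sum>e=1..N div d. moebius d * \<chi> d / of_nat d * (\<chi> e / of_nat e * f d e))"
    by (rule sum_divisors_swap)
  finally show ?thesis by (simp only: sum_distrib_left)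
qed

text \<open>The remainders \<open>C / sqrt (N / d)\<close> are summable against \<open>1 / d\<close>, uniformly in \<open>N\<close>.\<close>

lemma moebius_sum_remainder:
  assumes C: "C \<ge> 0" and g: "\<And>d. d \<in> {1..N} \<Longrightarrow> norm (g d - l) \<le> C / sqrt (real N / real d)"
  shows "norm ((\<Sum>d=1..N. moebius d * \<chi> d / of_nat d * g d) - l * M N) \<le> 2 * C"
proof -
  have "(\<Sum>d=1..N. moebius d * \<chi> d / of_nat d * g d) - l * M N =
        (\<Sum>d=1..N. moebius d * \<chi> d / of_nat d * (g d - l))"
    unfolding right_diff_distrib sum_subtractf sum_distrib_left by (simp add: mult_ac)
  also have "norm \<dots> \<le> (\<Sum>d=1..N. C / sqrt (real N) * (1 / sqrt (real d)))"
  proof (rule sum_norm_le)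
    fix d assume d: "d \<in> {1..N}"
    have "norm (moebius d * \<chi> d / of_nat d * (g d - l)) =
          norm (moebius d :: complex) * norm (\<chi> d) * norm (g d - l) / real d"
      by (simp add: norm_mult norm_divide)
    also have "\<dots> \<le> 1 * 1 * (C / sqrt (real N / real d)) / real d"
      using C by (intro divide_right_mono mult_mono norm_moebius_le norm_chi_le g d) auto
    also have "\<dots> = C / sqrt (real N) * (sqrt (real d) / real d)"
      by (simp add: real_sqrt_divide)
    also have "sqrt (real d) / real d = 1 / sqrt (real d)"
      using d by (simp add: field_simps)
    finally show "norm (moebius d * \<chi> d / of_nat d * (g d - l)) \<le> C / sqrt (real N) * (1 / sqrt (real d))" .
  qed
  also have "\<dots> = C / sqrt (real N) * (\<Sum>d=1..N. 1 / sqrt (real d))" by (simp add: sum_distrib_left)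
  also have "\<dots> \<le> C / sqrt (real N) * (2 * sqrt (real N))"
    using C by (intro mult_left_mono sum_inverse_sqrt_le) auto
  also have "\<dots> \<le> 2 * C" using C by (cases "N = 0") auto
  finally show ?thesis .
qed

text \<open>The truncated form of \<open>- L' / L = (- L') * (1 / L)\<close>: each inner sum is
  replaced by its limit \<open>l\<close>. Here \<open>l\<close> is a parameter so that callers can
  use one and the same limit in several estimates.\<close>

lemma K_eq_L1_M:
  assumes C: "C \<ge> 0" and
   l: "\<And>m. norm ((\<Sum>k=1..m. \<chi> k * of_real (ln (real k) / real k)) - l) \<le> C / sqrt (real (Suc m))"
  shows "norm (K N - l * M N) \<le> 2 * C"
proof -
  have "K N = (\<Sum>n=1..N. \<chi> n / of_nat n * (\<Sum>d | d dvd n. moebius d * of_real (ln (real (n div d)))))"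
    by (intro sum.cong) (simp_all add: moebius_ln_eq_mangoldt)
  also have "\<dots> = (\<Sum>d=1..N. moebius d * \<chi> d / of_nat d * (\<Sum>e=1..N div d. \<chi> e / of_nat e * of_real (ln (real e))))"
    by (rule twisted_convolution)
  also have "norm (\<dots> - l * M N) \<le> 2 * C"
  proof (rule moebius_sum_remainder[OF C])
    fix d assume d: "d \<in> {1..N}"
    have "(\<Sum>e=1..N div d. \<chi> e / of_nat e * of_real (ln (real e))) =
          (\<Sum>e=1..N div d. \<chi> e * of_real (ln (real e) / real e))" by simp
    then show "norm ((\<Sum>e=1..N div d. \<chi> e / of_nat e * of_real (ln (real e))) - l) \<le> C / sqrt (real N / real d)"
      using l[of "N div d"] div_remainder_mono[OF C d] by simp
  qed
  finally show ?thesis .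
qed

text \<open>The truncated form of \<open>L * (1 / L) = 1\<close>.\<close>

lemma L0_M_bounded:
  assumes N: "N > 0"
  shows "norm (1 - L0 * M N) \<le> 4 * B"
proof -
  have B0: "2 * B \<ge> 0" using sum_chi_le[of 0] by simp
  have "(\<Sum>n=1..N. \<chi> n / of_nat n * (\<Sum>d | d dvd n. moebius d * 1)) = (\<Sum>n=1..N. if n = 1 then 1 else 0)"
    by (intro sum.cong) (auto simp: sum_moebius_divisors chi_1[simplified])
  then have "1 = (\<Sum>n=1..N. \<chi> n / of_nat n * (\<Sum>d | d dvd n. moebius d * 1))"
    using N by simp
  also have "\<dots> = (\<Sum>d=1..N. moebius d * \<chi> d / of_nat d * (\<Sum>e=1..N div d. \<chi> e / of_nat e * 1))"
    by (rule twisted_convolution)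
  also have "norm (\<dots> - L0 * M N) \<le> 2 * (2 * B)"
  proof (rule moebius_sum_remainder[OF B0])
    fix d assume d: "d \<in> {1..N}"
    have "norm ((\<Sum>e=1..N div d. \<chi> e / of_nat e * 1) - L0) \<le> 2 * B / real (Suc (N div d))"
      using L0_bound[of "N div d"] by simp
    also have "\<dots> \<le> 2 * B / sqrt (real (Suc (N div d)))"
      using B0 real_sqrt_ge_one[of "real (Suc (N div d))"]
      by (intro divide_left_mono real_le_lsqrt mult_pos_pos) (auto simp: power2_eq_square simp del: of_nat_Suc)
    also have "\<dots> \<le> 2 * B / sqrt (real N / real d)" by (rule div_remainder_mono[OF B0 d])
    finally show "norm ((\<Sum>e=1..N div d. \<chi> e / of_nat e * 1) - L0) \<le> 2 * B / sqrt (real N / real d)" .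
  qed
  finally show ?thesis by simp
qed

lemma K_bounded:
  assumes "L0 \<noteq> 0"
  obtains C where "\<And>N. norm (K N) \<le> C"
proof -
  obtain l C where lC: "C \<ge> 0"
    "\<And>m. norm ((\<Sum>k=1..m. \<chi> k * of_real (ln (real k) / real k)) - l) \<le> C / sqrt (real (Suc m))"
    using L1_bound by blast
  have B0: "B \<ge> 0" using sum_chi_le[of 0] by simp
  have M: "norm (M N) \<le> (1 + 4 * B) / norm L0" for N
  proof (cases "N = 0")
    case False
    have "norm (L0 * M N) \<le> norm (1::complex) + norm (1 - L0 * M N)"
      using norm_triangle_ineq4[of 1 "1 - L0 * M N"] by simp
    then have "norm L0 * norm (M N) \<le> 1 + 4 * B"
      using L0_M_bounded[of N] False by (simp add: norm_mult)
    then show ?thesis using assms by (simp add: field_simps)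
  qed (use B0 in auto)
  have "norm (K N) \<le> 2 * C + norm l * ((1 + 4 * B) / norm L0)" for N
  proof -
    have "norm (K N) \<le> norm (K N - l * M N) + norm l * norm (M N)"
      using norm_triangle_sub[of "K N" "l * M N"] norm_mult[of l "M N"] by linarith
    also have "\<dots> \<le> 2 * C + norm l * ((1 + 4 * B) / norm L0)"
      by (intro add_mono K_eq_L1_M lC mult_left_mono M) auto
    finally show ?thesis .
  qed
  then show ?thesis using that by blast
qed

text \<open>A simple zero of \<open>L\<close> at 1 would give \<open>- L' / L\<close> a pole of
  residue \<open>-1\<close>, hence \<open>K N = - ln N + O(1)\<close>. The proof shows
  \<open>ln N = - l * M N + O(1)\<close> and compares with
  \<open>K N = l * M N + O(1)\<close>.\<close>

lemma K_of_L0_eq_0: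
  assumes "L0 = 0"
  obtains C where "\<And>N. N > 0 \<Longrightarrow> norm (K N + of_real (ln (real N))) \<le> C"
proof -
  obtain l C where lC: "C \<ge> 0"
    "\<And>m. norm ((\<Sum>k=1..m. \<chi> k * of_real (ln (real k) / real k)) - l) \<le> C / sqrt (real (Suc m))"
    using L1_bound by blast
  have B0: "B \<ge> 0" using sum_chi_le[of 0] by simp
  define C' where "C' = 4 * B + C"
  have C'0: "C' \<ge> 0" using B0 lC by (simp add: C'_def)
  have main: "norm (of_real (ln (real N)) - - l * M N) \<le> 2 * C'" if N: "N > 0" for N
  proof -
    \<comment> \<open>This weight depends only on \<open>d * e\<close>, so the Moebius sum leaves
      just \<open>ln N\<close>; yet its inner sum is \<open>ln y * S0 - S1\<close> with
      \<open>y = N / d\<close>, where \<open>S0 = O(1 / y)\<close> because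
      \<open>L0 = 0\<close>.\<close>
    define f where "f d e = complex_of_real (ln (real N / real (d * e)))" for d e
    have "(\<Sum>n=1..N. \<chi> n / of_nat n * (\<Sum>d | d dvd n. moebius d * f d (n div d))) =
          (\<Sum>n=1..N. if n = 1 then of_real (ln (real N)) else 0)"
    proof (intro sum.cong refl)
      fix n assume n: "n \<in> {1..N}"
      have "(\<Sum>d | d dvd n. moebius d * f d (n div d)) =
            (\<Sum>d | d dvd n. moebius d) * complex_of_real (ln (real N / real n))"
        unfolding sum_distrib_right by (intro sum.cong) (auto simp: f_def simp flip: of_nat_mult)
      then show "\<chi> n / of_nat n * (\<Sum>d | d dvd n. moebius d * f d (n div d)) =
                 (if n = 1 then of_real (ln (real N)) else 0)"
        using n by (auto simp: sum_moebius_divisors chi_1[simplified])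
    qed
    then have "of_real (ln (real N)) = (\<Sum>n=1..N. \<chi> n / of_nat n * (\<Sum>d | d dvd n. moebius d * f d (n div d)))"
      using N by simp
    also have "\<dots> = (\<Sum>d=1..N. moebius d * \<chi> d / of_nat d * (\<Sum>e=1..N div d. \<chi> e / of_nat e * f d e))"
      by (rule twisted_convolution)
    also have "norm (\<dots> - - l * M N) \<le> 2 * C'"
    proof (rule moebius_sum_remainder[OF C'0])
      fix d assume d: "d \<in> {1..N}"
      define y where "y = real N / real d"
      have y1: "y \<ge> 1" using d by (simp add: y_def)
      define S0 S1 where "S0 = (\<Sum>k=1..N div d. \<chi> k * of_real (1 / real k))"
        and "S1 = (\<Sum>k=1..N div d. \<chi> k * of_real (ln (real k) / real k))"
      have "(\<Sum>e=1..N div d. \<chi> e / of_nat e * f d e) = of_real (ln y) * S0 - S1"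
        unfolding S0_def S1_def sum_distrib_left sum_subtractf[symmetric]
      proof (intro sum.cong refl)
        fix e assume e: "e \<in> {1..N div d}"
        have "f d e = of_real (ln y - ln (real e))"
          using e d N by (simp add: f_def y_def ln_div ln_mult)
        then show "\<chi> e / of_nat e * f d e = of_real (ln y) * (\<chi> e * of_real (1 / real e)) - \<chi> e * of_real (ln (real e) / real e)"
          by (simp only: of_real_diff) (simp add: right_diff_distrib diff_divide_distrib)
      qed
      then have "norm ((\<Sum>e=1..N div d. \<chi> e / of_nat e * f d e) - - l) = norm (of_real (ln y) * S0 - (S1 - l))"
        by (simp only: diff_diff_eq2 diff_minus_eq_add) (simp add: algebra_simps)
      also have "\<dots> \<le> ln y * norm S0 + norm (S1 - l)"
        using y1 norm_triangle_ineq4[of "of_real (ln y) * S0" "S1 - l"] by (simp add: norm_mult)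
      also have "\<dots> \<le> 4 * B / sqrt y + C / sqrt y"
      proof (rule add_mono)
        have "ln y * norm S0 \<le> ln y * (2 * B / real (Suc (N div d)))"
          using L0_bound[of "N div d"] assms y1 by (intro mult_left_mono) (auto simp: S0_def)
        also have "\<dots> \<le> ln y * (2 * B / y)"
          using y1 B0 real_divide_le_Suc_div[of d N] d
          by (intro mult_left_mono divide_left_mono mult_pos_pos) (auto simp: y_def simp del: of_nat_Suc)
        also have "\<dots> = 2 * B * (ln y / y)" by simp
        also have "\<dots> \<le> 2 * B * (2 / sqrt y)"
          using y1 B0 by (intro mult_left_mono ln_over_self_le_inverse_sqrt) auto
        finally show "ln y * norm S0 \<le> 4 * B / sqrt y" by simp
        show "norm (S1 - l) \<le> C / sqrt y"
          using lC(2)[of "N div d"] div_remainder_mono[OF lC(1) d] by (simp add: S1_def y_def)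
      qed
      finally show "norm ((\<Sum>e=1..N div d. \<chi> e / of_nat e * f d e) - - l) \<le> C' / sqrt (real N / real d)"
        by (simp add: C'_def y_def add_divide_distrib)
    qed
    finally show ?thesis .
  qed
  have "norm (K N + of_real (ln (real N))) \<le> 2 * C + 2 * C'" if "N > 0" for N
  proof -
    have "K N + of_real (ln (real N)) = (K N - l * M N) + (of_real (ln (real N)) - - l * M N)" by simp
    also have "norm \<dots> \<le> 2 * C + 2 * C'"
      by (intro norm_triangle_le add_mono K_eq_L1_M lC main that)
    finally show ?thesis .
  qed
  then show ?thesis using that by blast
qed

end

section \<open>Real characters\<close>

lemma inverse_sqrt_le_diff:
  fixes a b :: real
  assumes "0 < a" "a \<le> b"
  shows "(b - a) / sqrt b \<le> 2 * (sqrt b - sqrt a)" "2 * (sqrt b - sqrt a) \<le> (b - a) / sqrt a"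
proof -
  define u v where "u = sqrt a" and "v = sqrt b"
  have uv: "0 < u" "u \<le> v" "a = u * u" "b = v * v" using assms by (auto simp: u_def v_def)
  have e: "b - a = (v - u) * (v + u)" by (simp add: uv algebra_simps)
  have "(v - u) * (v + u) \<le> (v - u) * (2 * v)" using uv by (intro mult_left_mono) auto
  then show "(b - a) / sqrt b \<le> 2 * (sqrt b - sqrt a)"
    unfolding e u_def[symmetric] v_def[symmetric] using uv by (simp add: pos_divide_le_eq mult_ac)
  have "(v - u) * (2 * u) \<le> (v - u) * (v + u)" using uv by (intro mult_left_mono) auto
  then show "2 * (sqrt b - sqrt a) \<le> (b - a) / sqrt a"
    unfolding e u_def[symmetric] v_def[symmetric] using uv by (simp add: pos_le_divide_eq mult_ac)
qed

text \<open>The constant is the value of the zeta function at 1/2, found between an increasing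
  sequence \<open>s\<close> and a decreasing sequence \<open>u\<close>. A real \<open>y\<close>
  between \<open>m\<close> and \<open>Suc m\<close> is allowed because the lemma is applied with
  \<open>m = N div d\<close> and \<open>y = N / d\<close>.\<close>

lemma sum_inverse_sqrt_asymp:
  obtains c where "\<And>y m. 0 < y \<Longrightarrow> real m \<le> y \<Longrightarrow> y \<le> real (Suc m) \<Longrightarrow>
    \<bar>(\<Sum>e=1..m. 1 / sqrt (real e)) - 2 * sqrt y - c\<bar> \<le> 1 / sqrt y"
proof -
  define s where "s m = (\<Sum>e=1..m. 1 / sqrt (real e)) - 2 * sqrt (real (Suc m))" for m
  define u where "u m = s m + 1 / sqrt (real (Suc m))" for m
  have step: "s m \<le> s (Suc m)" "u (Suc m) \<le> u m" for m
    using inverse_sqrt_le_diff[of "real (Suc m)" "real (Suc (Suc m))"]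
    by (auto simp: s_def u_def)
  have s: "s m \<le> s n" if "m \<le> n" for m n using lift_Suc_mono_le[of s, OF step(1) that] .
  have u: "u n \<le> u m" if "m \<le> n" for m n using lift_Suc_antimono_le[of u, OF step(2) that] .
  have su: "s n \<le> u n" for n by (simp add: u_def)
  have su': "s n \<le> u m" for m n
    by (metis s u su linear order_trans)
  define c where "c = (SUP m. s m)"
  have "bdd_above (range s)" using su'[of _ 0] by (intro bdd_aboveI[of _ "u 0"]) auto
  then have c1: "s m \<le> c" for m unfolding c_def by (intro cSUP_upper) auto
  have c2: "c \<le> u m" for m unfolding c_def by (intro cSUP_least su') auto
  have "\<bar>(\<Sum>e=1..m. 1 / sqrt (real e)) - 2 * sqrt y - c\<bar> \<le> 1 / sqrt y"
    if y: "0 < y" "real m \<le> y" "y \<le> real (Suc m)" for y m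
  proof -
    have "2 * (sqrt (real (Suc m)) - sqrt y) \<le> (real (Suc m) - y) / sqrt y"
      using y by (intro inverse_sqrt_le_diff) auto
    also have "\<dots> \<le> 1 / sqrt y" using y by (intro divide_right_mono) auto
    finally have 1: "2 * sqrt (real (Suc m)) - 2 * sqrt y \<le> 1 / sqrt y" by simp
    have 2: "sqrt y \<le> sqrt (real (Suc m))" using y by (simp del: of_nat_Suc)
    have 3: "1 / sqrt (real (Suc m)) \<le> 1 / sqrt y" using y 2 by (intro divide_left_mono mult_pos_pos) auto
    show ?thesis using c1[of m] c2[of m] 1 2 3 unfolding u_def s_def by linarith
  qed
  then show ?thesis using that by blast
qed

lemma ln_le_harmonic_sum: "ln (real n) \<le> (\<Sum>k=1..n. 1 / real k)"
proof -
  have "ln (real (Suc n)) \<le> (\<Sum>k=1..n. 1 / real k)"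
  proof (induction n)
    case (Suc n)
    have "ln (real (Suc (Suc n))) = ln (real (Suc n)) + ln (1 + 1 / real (Suc n))"
      by (subst ln_mult_pos [symmetric]) (auto simp: distrib_left intro: add_pos_nonneg)
    also have "\<dots> \<le> ln (real (Suc n)) + 1 / real (Suc n)"
      using ln_add_one_self_le_self[of "1 / real (Suc n)"] by simp
    finally show ?case using Suc by simp
  qed simp
  moreover have "ln (real n) \<le> ln (real (Suc n))" by (cases "n = 0") auto
  ultimately show ?thesis by linarith
qed

text \<open>The divisor sum is multiplicative, and its factor at a prime power is a sum of powers of
  \<open>-1\<close>, \<open>0\<close> or \<open>1\<close>: never negative, and at least 1 when the
  exponent is even.\<close>

lemma sum_divisors_real_character:
  fixes \<rho> :: "nat \<Rightarrow> real"
  assumes one: "\<rho> 1 = 1" and mult: "\<And>m n. \<rho> (m * n) = \<rho> m * \<rho> n"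
    and vals: "\<And>n. \<rho> n \<in> {-1, 0, 1}" and n: "n > 0"
  shows "(\<Sum>d | d dvd n. \<rho> d) \<ge> 0" "(\<Sum>d | d dvd n ^ 2. \<rho> d) \<ge> 1"
proof -
  have pow: "\<rho> (p ^ i) = \<rho> p ^ i" for p i
    by (induction i) (auto simp: one[simplified] mult)
  have step: "(\<Sum>d | d dvd p ^ k * m. \<rho> d) = (\<Sum>i\<le>k. \<rho> p ^ i) * (\<Sum>d | d dvd m. \<rho> d)"
    if "prime p" "\<not> p dvd m" for p k m
    unfolding sum_divisors_prime_power_mult[OF that] by (simp add: mult pow sum_product)
  have alt: "(\<Sum>i\<le>k. (-1) ^ i) = (if even k then 1 else (0::real))" for k
    by (induction k) auto
  have geo: "(\<Sum>i\<le>k. \<rho> p ^ i) \<ge> 0" "(\<Sum>i\<le>2 * k. \<rho> p ^ i) \<ge> 1" for p k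
    using vals[of p] by (auto simp: alt power_0_left)
  have "(\<Sum>d | d dvd n. \<rho> d) \<ge> 0 \<and> (\<Sum>d | d dvd n ^ 2. \<rho> d) \<ge> 1"
    using n
  proof (induction n rule: less_induct)
    case (less n)
    show ?case
    proof (cases "n = 1")
      case True
      then show ?thesis by (simp add: one[simplified])
    next
      case False
      with less have "n > 1" by simp
      then obtain p k m where *: "prime p" "\<not> p dvd m" "n = p ^ k * m" "m < n" "m > 0"
        by (rule prime_power_decomp)
      have n2: "n ^ 2 = p ^ (2 * k) * m ^ 2" by (simp add: * power_mult_distrib power_mult mult.commute)
      have "\<not> p dvd m ^ 2" using * prime_dvd_power by blast
      then have "(\<Sum>d | d dvd n ^ 2. \<rho> d) = (\<Sum>i\<le>2 * k. \<rho> p ^ i) * (\<Sum>d | d dvd m ^ 2. \<rho> d)"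
        unfolding n2 using * by (intro step)
      moreover have "(\<Sum>d | d dvd n. \<rho> d) = (\<Sum>i\<le>k. \<rho> p ^ i) * (\<Sum>d | d dvd m. \<rho> d)"
        unfolding *(3) using * by (intro step)
      moreover have "(\<Sum>i\<le>2 * k. \<rho> p ^ i) * (\<Sum>d | d dvd m ^ 2. \<rho> d) \<ge> 1 * 1"
        using geo[of p k] geo(2)[of p k] less.IH[of m] * by (intro mult_mono) auto
      ultimately show ?thesis using geo(1)[of p k] less.IH[of m] * by auto
    qed
  qed
  then show "(\<Sum>d | d dvd n. \<rho> d) \<ge> 0" "(\<Sum>d | d dvd n ^ 2. \<rho> d) \<ge> 1" by auto
qed

text \<open>
  Dirichlet's hyperbola method for \<open>\<Sum>n\<le>N. r n / sqrt n\<close>, where \<open>r n = \<Sum>d dvd n. \<chi> d\<close> is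
  nonnegative and at least 1 on squares: the sum grows like a harmonic series, but it would
  stay bounded if \<open>L(1, \<chi>)\<close> vanished.
\<close>

lemma (in bounded_character) L0_nonzero_of_real:
  assumes vals: "\<And>n. \<chi> n \<in> {-1, 0, 1}"
  shows "L0 \<noteq> 0"
proof
  assume L0: "L0 = 0"
  define \<rho> where "\<rho> n = Re (\<chi> n)" for n
  have chi: "\<chi> n = of_real (\<rho> n)" for n using vals[of n] by (auto simp: \<rho>_def)
  have rho: "\<rho> 1 = 1" "\<rho> (m * n) = \<rho> m * \<rho> n" "\<rho> n \<in> {-1, 0, 1}" for m n
  proof -
    show "\<rho> 1 = 1" using chi_1 by (simp add: \<rho>_def)
    have "complex_of_real (\<rho> (m * n)) = of_real (\<rho> m * \<rho> n)"
      using chi_mult[of m n] by (simp only: of_real_mult chi)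
    then show "\<rho> (m * n) = \<rho> m * \<rho> n" by (simp only: of_real_eq_iff)
    show "\<rho> n \<in> {-1, 0, 1}" using vals[of n] by (auto simp: \<rho>_def)
  qed
  have rho_le: "\<bar>\<rho> n\<bar> \<le> 1" for n using rho(3)[of n] by auto
  have B0: "B \<ge> 0" using sum_chi_le[of 0] by simp
  define r where "r n = (\<Sum>d | d dvd n. \<rho> d)" for n
  have abel: "\<bar>\<Sum>k=Suc m..n. \<rho> k / sqrt (real k)\<bar> \<le> 2 * B / sqrt (real (Suc m))" for m n
  proof -
    have "norm (\<Sum>k=Suc m..n. \<chi> k * of_real (1 / sqrt (real k))) \<le> 2 * B * (1 / sqrt (real (Suc m)))"
      using sum_chi_le by (intro abel_summation_bound) (auto simp: frac_le)
    also have "(\<Sum>k=Suc m..n. \<chi> k * of_real (1 / sqrt (real k))) = of_real (\<Sum>k=Suc m..n. \<rho> k / sqrt (real k))"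
      by (simp add: chi)
    finally show ?thesis by (simp only: norm_of_real) simp
  qed
  have L: "\<bar>\<Sum>k=1..m. \<rho> k / real k\<bar> \<le> 2 * B / real (Suc m)" for m
  proof -
    have "(\<Sum>k=1..m. \<chi> k * of_real (1 / real k)) = of_real (\<Sum>k=1..m. \<rho> k / real k)" by (simp add: chi)
    then show ?thesis using L0_bound[of m] unfolding L0 by (simp only: diff_0_right norm_of_real)
  qed
  obtain c where c: "\<And>y m. 0 < y \<Longrightarrow> real m \<le> y \<Longrightarrow> y \<le> real (Suc m) \<Longrightarrow>
    \<bar>(\<Sum>e=1..m. 1 / sqrt (real e)) - 2 * sqrt y - c\<bar> \<le> 1 / sqrt y"
    using sum_inverse_sqrt_asymp by blast
  have upper: "(\<Sum>n=1..M^2. r n / sqrt (real n)) \<le> 8 * B + 2 * B * \<bar>c\<bar> + 1" if M: "M > 0" for M :: nat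
  proof -
    \<comment> \<open>A square, so that the hyperbola is split at the integer
      \<open>sqrt N = M\<close>.\<close>
    define N where "N = M ^ 2"
    define H where "H m = (\<Sum>e=1..m. 1 / sqrt (real e))" for m
    have MN: "M \<le> N" "sqrt (real N) = real M" using M by (auto simp: N_def power2_eq_square)
    have "(\<Sum>n=1..N. r n / sqrt (real n)) =
          (\<Sum>n=1..N. \<Sum>d | d dvd n. \<rho> d / sqrt (real d) * (1 / sqrt (real (n div d))))"
      unfolding r_def sum_divide_distrib
    proof (intro sum.cong refl)
      fix n d assume "n \<in> {1..N}" "d \<in> {d. d dvd n}"
      then obtain e where "n = d * e" "d > 0" by (auto elim!: dvdE intro: Nat.gr0I)
      then show "\<rho> d / sqrt (real n) = \<rho> d / sqrt (real d) * (1 / sqrt (real (n div d)))"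
        by (simp add: real_sqrt_mult)
    qed
    also have "\<dots> = (\<Sum>d=1..N. \<Sum>e=1..N div d. \<rho> d / sqrt (real d) * (1 / sqrt (real e)))"
      by (rule sum_divisors_swap)
    also have "\<dots> = (\<Sum>d=1..M. \<Sum>e=1..N div d. \<rho> d / sqrt (real d) * (1 / sqrt (real e)))
                  + (\<Sum>d=Suc M..N. \<Sum>e=1..N div d. \<rho> d / sqrt (real d) * (1 / sqrt (real e)))"
      using sum.ub_add_nat[of 1 M _ "N - M"] MN by simp
    \<comment> \<open>For \<open>d \<le> M\<close> the sum over \<open>e\<close> is expanded as
      \<open>2 * sqrt (N / d) + c + E d\<close>. Its leading term contributes \<open>2 * M\<close>
      times a partial sum of \<open>L(1, \<chi>)\<close>, which is bounded because
      \<open>L0 = 0\<close>.\<close>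
    also have "(\<Sum>d=1..M. \<Sum>e=1..N div d. \<rho> d / sqrt (real d) * (1 / sqrt (real e))) \<le> 4 * B + 2 * B * \<bar>c\<bar> + 1"
    proof -
      define E where "E d = H (N div d) - 2 * sqrt (real N / real d) - c" for d
      have E: "\<bar>E d\<bar> \<le> sqrt (real d) / real M" if "d \<in> {1..M}" for d
      proof -
        have "real (N div d) \<le> real N / real d" by (rule of_nat_div_le_of_nat)
        then have "\<bar>E d\<bar> \<le> 1 / sqrt (real N / real d)"
          using real_divide_le_Suc_div[of d N] that M unfolding E_def H_def by (intro c) (auto simp: N_def)
        then show ?thesis by (simp add: real_sqrt_divide MN)
      qed
      have "(\<Sum>d=1..M. \<Sum>e=1..N div d. \<rho> d / sqrt (real d) * (1 / sqrt (real e))) =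
            (\<Sum>d=1..M. 2 * real M * (\<rho> d / real d) + c * (\<rho> d / sqrt (real d)) + \<rho> d / sqrt (real d) * E d)"
      proof (intro sum.cong refl)
        fix d assume d: "d \<in> {1..M}"
        have "(\<Sum>e=1..N div d. \<rho> d / sqrt (real d) * (1 / sqrt (real e))) = \<rho> d / sqrt (real d) * H (N div d)"
          by (simp add: H_def sum_distrib_left)
        also have "H (N div d) = 2 * real M / sqrt (real d) + c + E d"
          by (simp add: E_def real_sqrt_divide MN)
        also have "\<rho> d / sqrt (real d) * \<dots> = 2 * real M * (\<rho> d / (sqrt (real d) * sqrt (real d))) + c * (\<rho> d / sqrt (real d)) + \<rho> d / sqrt (real d) * E d"
          by (simp add: algebra_simps)
        finally show "(\<Sum>e=1..N div d. \<rho> d / sqrt (real d) * (1 / sqrt (real e))) =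
           2 * real M * (\<rho> d / real d) + c * (\<rho> d / sqrt (real d)) + \<rho> d / sqrt (real d) * E d"
          by simp
      qed
      also have "\<dots> = 2 * real M * (\<Sum>d=1..M. \<rho> d / real d) + c * (\<Sum>d=1..M. \<rho> d / sqrt (real d))
                    + (\<Sum>d=1..M. \<rho> d / sqrt (real d) * E d)"
        by (simp add: sum.distrib sum_distrib_left)
      also have "\<dots> \<le> 4 * B + 2 * B * \<bar>c\<bar> + 1"
      proof (intro add_mono)
        have "2 * real M * (\<Sum>d=1..M. \<rho> d / real d) \<le> 2 * real M * (2 * B / real (Suc M))"
          using L[of M] by (intro mult_left_mono) auto
        also have "\<dots> = 4 * B * (real M / real (Suc M))" by simp
        also have "\<dots> \<le> 4 * B * 1" using B0 by (intro mult_left_mono) auto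
        finally show "2 * real M * (\<Sum>d=1..M. \<rho> d / real d) \<le> 4 * B" by simp
        have "c * (\<Sum>d=1..M. \<rho> d / sqrt (real d)) \<le> \<bar>c\<bar> * \<bar>\<Sum>d=1..M. \<rho> d / sqrt (real d)\<bar>"
          using abs_ge_self[of "c * (\<Sum>d=1..M. \<rho> d / sqrt (real d))"] by (simp only: abs_mult)
        also have "\<dots> \<le> \<bar>c\<bar> * (2 * B)" using abel[of 0 M] by (intro mult_left_mono) auto
        finally show "c * (\<Sum>d=1..M. \<rho> d / sqrt (real d)) \<le> 2 * B * \<bar>c\<bar>" by (simp add: mult_ac)
        have "(\<Sum>d=1..M. \<rho> d / sqrt (real d) * E d) \<le> (\<Sum>d=1..M. 1 / real M)"
        proof (rule sum_mono)
          fix d assume d: "d \<in> {1..M}"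
          have "\<rho> d / sqrt (real d) * E d \<le> \<bar>\<rho> d\<bar> / sqrt (real d) * \<bar>E d\<bar>"
            using abs_ge_self[of "\<rho> d / sqrt (real d) * E d"] by (simp add: abs_mult)
          also have "\<dots> \<le> 1 / sqrt (real d) * (sqrt (real d) / real M)"
            using E[OF d] rho_le by (intro mult_mono divide_right_mono) auto
          also have "\<dots> = 1 / real M" using d by simp
          finally show "\<rho> d / sqrt (real d) * E d \<le> 1 / real M" .
        qed
        also have "\<dots> = 1" using M by simp
        finally show "(\<Sum>d=1..M. \<rho> d / sqrt (real d) * E d) \<le> 1" .
      qed
      finally show ?thesis .
    qed
    also have "(\<Sum>d=Suc M..N. \<Sum>e=1..N div d. \<rho> d / sqrt (real d) * (1 / sqrt (real e))) =
               (\<Sum>e=1..M. \<Sum>d=Suc M..N div e. \<rho> d / sqrt (real d) * (1 / sqrt (real e)))"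
    proof -
      \<comment> \<open>Since \<open>N = M ^ 2\<close>, \<open>d > M\<close> and
        \<open>d * e \<le> N\<close> force \<open>e \<le> M\<close>; with \<open>d\<close>
        innermost, \<open>abel\<close> exploits the cancellation in \<open>\<rho>\<close>.\<close>
      have iff: "(d \<in> {Suc M..N} \<and> e \<in> {1..N div d}) \<longleftrightarrow> (e \<in> {1..M} \<and> d \<in> {Suc M..N div e})" for d e
      proof -
        have "e \<le> M" if "d > M" "d * e \<le> N"
        proof (rule ccontr)
          assume "\<not> e \<le> M"
          then have "M * M < d * e" using that by (intro mult_strict_mono) auto
          with that show False by (simp add: N_def power2_eq_square)
        qed
        moreover have "d \<le> N" if "d * e \<le> N" "e > 0" using that
          by (metis One_nat_def Suc_leI le_trans mult.right_neutral mult_le_mono2)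
        ultimately show ?thesis
          by (auto simp: less_eq_div_iff_mult_less_eq Suc_le_eq mult.commute)
      qed
      show ?thesis
        by (subst (1 2) sum.Sigma, simp, simp, simp, simp)
           (rule sum.reindex_bij_witness[where i = prod.swap and j = prod.swap],
            simp_all del: atLeastAtMost_iff One_nat_def add: iff split_paired_all)
    qed
    also have "\<dots> \<le> (\<Sum>e=1..M. 2 * B / sqrt (real (Suc M)) * (1 / sqrt (real e)))"
    proof (rule sum_mono)
      fix e assume "e \<in> {1..M}"
      have "(\<Sum>d=Suc M..N div e. \<rho> d / sqrt (real d) * (1 / sqrt (real e))) =
            (\<Sum>d=Suc M..N div e. \<rho> d / sqrt (real d)) * (1 / sqrt (real e))"
        by (simp only: sum_distrib_right)
      also have "\<dots> \<le> 2 * B / sqrt (real (Suc M)) * (1 / sqrt (real e))"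
        using abel[of M "N div e"] by (intro mult_right_mono) auto
      finally show "(\<Sum>d=Suc M..N div e. \<rho> d / sqrt (real d) * (1 / sqrt (real e))) \<le>
        2 * B / sqrt (real (Suc M)) * (1 / sqrt (real e))" .
    qed
    also have "\<dots> = 2 * B / sqrt (real (Suc M)) * (\<Sum>e=1..M. 1 / sqrt (real e))"
      by (simp add: sum_distrib_left)
    also have "\<dots> \<le> 2 * B / sqrt (real (Suc M)) * (2 * sqrt (real M))"
      using B0 by (intro mult_left_mono sum_inverse_sqrt_le) auto
    also have "\<dots> = 4 * B * (sqrt (real M) / sqrt (real (Suc M)))" by simp
    also have "\<dots> \<le> 4 * B * 1" using B0 by (intro mult_left_mono) auto
    finally show ?thesis unfolding N_def by simp
  qed
  have lower: "(\<Sum>m=1..M. 1 / real m) \<le> (\<Sum>n=1..M^2. r n / sqrt (real n))" for M :: nat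
  proof -
    have "(\<Sum>m=1..M. 1 / real m) \<le> (\<Sum>m=1..M. r (m^2) / sqrt (real (m^2)))"
      using sum_divisors_real_character(2)[of \<rho>] rho by (intro sum_mono) (auto simp: r_def divide_right_mono)
    also have "\<dots> = (\<Sum>n\<in>(\<lambda>m. m^2) ` {1..M}. r n / sqrt (real n))"
      by (subst sum.reindex) (auto simp: inj_on_def)
    also have "\<dots> \<le> (\<Sum>n=1..M^2. r n / sqrt (real n))"
      using sum_divisors_real_character(1)[of \<rho>] rho by (intro sum_mono2) (auto simp: r_def power_mono)
    finally show ?thesis .
  qed
  define X where "X = 8 * B + 2 * B * \<bar>c\<bar> + 1"
  have "eventually (\<lambda>M. X < ln (real M)) sequentially"
    using filterlim_compose[OF ln_at_top filterlim_real_sequentially] by (simp add: filterlim_at_top_dense)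
  then have "\<exists>M. (\<Sum>m=1..M. 1 / real m) > 8 * B + 2 * B * \<bar>c\<bar> + 1"
    using ln_le_harmonic_sum by (fastforce simp: eventually_sequentially X_def intro: less_le_trans)
  then obtain M where M: "(\<Sum>m=1..M. 1 / real m) > 8 * B + 2 * B * \<bar>c\<bar> + 1" ..
  have "0 \<le> 8 * B + 2 * B * \<bar>c\<bar> + 1" using B0 by simp
  with M have "M > 0" by (cases "M = 0") auto
  from upper[OF this] lower[of M] M show False by linarith
qed

section \<open>Chebyshev and Mertens estimates\<close>

text \<open>Legendre's formula for the factorial. Terms with \<open>d > N\<close> vanish, so the
  range may be extended to \<open>D\<close>; this puts the formulas for \<open>n\<close> and
  \<open>2 * n\<close> on a common range.\<close>

lemma sum_mangoldt_div:
  assumes "N \<le> D"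
  shows "(\<Sum>d=1..D. mangoldt d * real (N div d)) = ln (fact N)"
proof -
  have "ln (fact N) = (\<Sum>n=1..N. ln (real n))"
    by (induction N) (simp_all add: ln_mult)
  also have "\<dots> = (\<Sum>n=1..N. \<Sum>d | d dvd n. mangoldt d)"
    by (intro sum.cong) (simp_all add: mangoldt_sum)
  also have "\<dots> = (\<Sum>d=1..N. \<Sum>e=1..N div d. mangoldt d)"
    by (rule sum_divisors_swap)
  also have "\<dots> = (\<Sum>d=1..N. mangoldt d * real (N div d))" by (simp add: mult.commute)
  also have "\<dots> = (\<Sum>d=1..D. mangoldt d * real (N div d))"
    using assms by (intro sum.mono_neutral_left) auto
  finally show ?thesis ..
qed

text \<open>Passing from \<open>n\<close> to \<open>2 * n\<close> adds at most \<open>2 * n\<close>,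
  by the central binomial coefficient, and an odd \<open>N\<close> adds one term of size at most
  \<open>N\<close>. The constant closes the induction:
  \<open>4 * n + 2 * n + N \<le> 4 * N\<close>.\<close>

lemma chebyshev_upper_bound: "(\<Sum>d=1..N. mangoldt d) \<le> 4 * real N"
proof (induction N rule: less_induct)
  case (less N)
  define n where "n = N div 2"
  define P where "P m = (\<Sum>d=1..m. mangoldt d :: real)" for m
  show ?case
  proof (cases "N = 0")
    case False
    then have nN: "n < N" "N = 2 * n \<or> N = Suc (2 * n)" by (auto simp: n_def)
    have "P (2 * n) = P n + (\<Sum>d=Suc n..2 * n. mangoldt d)"
      unfolding P_def using sum.ub_add_nat[of 1 n mangoldt n] by (simp add: mult_2)
    moreover have "(\<Sum>d=Suc n..2 * n. mangoldt d :: real) \<le> 2 * real n"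
    proof -
      \<comment> \<open>The bracket is never negative and is at least 1 for
        \<open>n < d \<le> 2 * n\<close>.\<close>
      have "(\<Sum>d=Suc n..2 * n. mangoldt d :: real) \<le>
            (\<Sum>d=Suc n..2 * n. mangoldt d * (real (2 * n div d) - 2 * real (n div d)))"
      proof (rule sum_mono)
        fix d assume d: "d \<in> {Suc n..2 * n}"
        then have "1 \<le> 2 * n div d" by (simp add: less_eq_div_iff_mult_less_eq)
        moreover have "n div d = 0" using d by simp
        ultimately show "mangoldt d \<le> mangoldt d * (real (2 * n div d) - 2 * real (n div d))"
          using mangoldt_nonneg[of d] by (simp add: mult_le_cancel_left1)
      qed
      also have "\<dots> \<le> (\<Sum>d=1..2 * n. mangoldt d * (real (2 * n div d) - 2 * real (n div d)))"
      proof (intro sum_mono2 mult_nonneg_nonneg mangoldt_nonneg)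
        fix d
        have "2 * (n div d) \<le> 2 * n div d"
          by (cases "d = 0") (auto simp: less_eq_div_iff_mult_less_eq)
        then show "0 \<le> real (2 * n div d) - 2 * real (n div d)" by linarith
      qed auto
      also have "\<dots> = (\<Sum>d=1..2 * n. mangoldt d * real (2 * n div d)) - 2 * (\<Sum>d=1..2 * n. mangoldt d * real (n div d))"
        by (simp add: right_diff_distrib sum_subtractf sum_distrib_left mult.left_commute)
      also have "\<dots> = ln (fact (2 * n)) - 2 * ln (fact n)"
        by (simp only: sum_mangoldt_div[of "2 * n" "2 * n"] sum_mangoldt_div[of n "2 * n"])
      also have "\<dots> = ln (real (2 * n choose n))"
      proof -
        have "real (2 * n choose n) = fact (2 * n) / (fact n * fact n)"
          using binomial_fact[of n "2 * n", where ?'a = real] by simp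
        then show ?thesis by (simp only: ln_div ln_mult fact_gt_zero mult_pos_pos fact_nonzero) (simp add: ln_div ln_mult)
      qed
      also have "\<dots> \<le> ln (real (2 ^ (2 * n)))"
        using binomial_le_pow2[of "2 * n" n] by (subst ln_le_cancel_iff) (auto simp flip: of_nat_le_iff)
      also have "\<dots> = 2 * real n * ln 2" by (simp add: ln_realpow)
      also have "\<dots> \<le> 2 * real n * 1" using ln_2_less_1 by (intro mult_left_mono) auto
      finally show ?thesis by simp
    qed
    moreover have "P n \<le> 4 * real n" using less.IH[OF nN(1)] by (simp add: P_def)
    moreover have "P N \<le> P (2 * n) + real N"
    proof -
      have "mangoldt N \<le> ln (real N)" using False by (intro mangoldt_le) simp
      also have "\<dots> \<le> real N" using ln_le_minus_one[of "real N"] False by simp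
      finally show ?thesis using nN(2) by (auto simp: P_def)
    qed
    ultimately show ?thesis using nN(2) by (auto simp: P_def)
  qed simp
qed

lemma ln_fact_bounds:
  "real N * ln (real N) - real N \<le> ln (fact N)" "ln (fact N) \<le> real N * ln (real N)"
proof -
  show "real N * ln (real N) - real N \<le> ln (fact N)"
  proof (induction N)
    case (Suc N)
    show ?case
    proof (cases "N = 0")
      case False
      have "ln (real (Suc N)) = ln (real N) + ln (1 + 1 / real N)"
        using False by (subst ln_mult_pos [symmetric]) (auto simp: distrib_left intro: add_pos_nonneg)
      also have "ln (1 + 1 / real N) \<le> 1 / real N"
        by (rule ln_add_one_self_le_self) auto
      finally have "real N * ln (real (Suc N)) \<le> real N * (ln (real N) + 1 / real N)"
        by (intro mult_left_mono) auto
      also have "\<dots> = real N * ln (real N) + 1" using False by (simp add: distrib_left)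
      finally have "real N * ln (real (Suc N)) \<le> ln (fact N) + real N + 1" using Suc by linarith
      moreover have "ln (fact (Suc N) :: real) = ln (real (Suc N)) + ln (fact N)"
        by (simp add: ln_mult)
      ultimately show ?thesis by (simp add: algebra_simps)
    qed simp
  qed simp
  have "ln (fact N :: real) \<le> ln (real N ^ N)"
    using fact_le_power[of N, where ?'a = real] by (cases "N = 0") (auto simp: ln_le_cancel_iff)
  then show "ln (fact N) \<le> real N * ln (real N)" by (cases "N = 0") (auto simp: ln_realpow)
qed

text \<open>Replacing \<open>N div n\<close> by \<open>N / n\<close> in Legendre's formula can only
  increase the sum, and by at most Chebyshev's \<open>4 * N\<close>.\<close>

lemma mertens_mangoldt:
  assumes "N > 0"
  shows "ln (real N) - 1 \<le> (\<Sum>n=1..N. mangoldt n / real n)"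
    and "(\<Sum>n=1..N. mangoldt n / real n) \<le> ln (real N) + 4"
proof -
  have eq: "real N * (\<Sum>n=1..N. mangoldt n / real n) = (\<Sum>n=1..N. mangoldt n * (real N / real n))"
    by (simp add: sum_distrib_left mult_ac)
  have "real N * ln (real N) - real N \<le> (\<Sum>n=1..N. mangoldt n * real (N div n))"
    using ln_fact_bounds(1)[of N] sum_mangoldt_div[of N N] by simp
  also have "\<dots> \<le> (\<Sum>n=1..N. mangoldt n * (real N / real n))"
    by (intro sum_mono mult_left_mono mangoldt_nonneg of_nat_div_le_of_nat)
  finally have "real N * (ln (real N) - 1) \<le> real N * (\<Sum>n=1..N. mangoldt n / real n)"
    unfolding eq by (simp add: algebra_simps)
  then show "ln (real N) - 1 \<le> (\<Sum>n=1..N. mangoldt n / real n)"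
    using assms by simp
  have "(\<Sum>n=1..N. mangoldt n * (real N / real n)) \<le> (\<Sum>n=1..N. mangoldt n * (real (N div n) + 1))"
    using real_divide_le_Suc_div by (intro sum_mono mult_left_mono mangoldt_nonneg) (auto simp: add.commute)
  also have "\<dots> = ln (fact N) + (\<Sum>n=1..N. mangoldt n)"
    using sum_mangoldt_div[of N N] by (simp add: distrib_left sum.distrib)
  also have "\<dots> \<le> real N * ln (real N) + 4 * real N"
    using ln_fact_bounds(2)[of N] chebyshev_upper_bound[of N] by linarith
  finally have "real N * (\<Sum>n=1..N. mangoldt n / real n) \<le> real N * (ln (real N) + 4)"
    unfolding eq by (simp add: algebra_simps)
  then show "(\<Sum>n=1..N. mangoldt n / real n) \<le> ln (real N) + 4"
    using assms by simp
qed

text \<open>Only proper prime powers contribute. For each \<open>p\<close> they give at most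
  \<open>4 / (p * sqrt p)\<close>, and the sum of \<open>1 / (p * sqrt p)\<close> over
  \<open>p \<ge> 2\<close> is at most 2.\<close>

lemma sum_nonprime_mangoldt_bounded:
  "(\<Sum>n | n \<in> {1..N} \<and> \<not> prime n. mangoldt n / real n) \<le> 8"
proof -
  define S where "S = {n \<in> {1..N}. \<not> prime n \<and> primepow n}"
  have "(\<Sum>n | n \<in> {1..N} \<and> \<not> prime n. mangoldt n / real n) = (\<Sum>n\<in>S. mangoldt n / real n)"
    by (intro sum.mono_neutral_right) (auto simp: S_def mangoldt_def)
  also have "\<dots> \<le> (\<Sum>n\<in>(\<lambda>(p,k). p ^ k) ` ({p \<in> {2..N}. prime p} \<times> {2..N}). mangoldt n / real n)"
  proof (rule sum_mono2)
    show "S \<subseteq> (\<lambda>(p,k). p ^ k) ` ({p \<in> {2..N}. prime p} \<times> {2..N})"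
    proof
      fix n assume n: "n \<in> S"
      then obtain p k where pk: "prime p" "k > 0" "n = p ^ k"
        by (auto simp: S_def primepow_def)
      have p2: "p \<ge> 2" using pk prime_ge_2_nat by auto
      have "k \<noteq> 1" using n pk by (auto simp: S_def)
      moreover have "k < p ^ k" by (rule power_gt_expt) (use p2 in auto)
      moreover have "p \<le> p ^ k" using pk p2 by (intro self_le_power) auto
      ultimately show "n \<in> (\<lambda>(p,k). p ^ k) ` ({p \<in> {2..N}. prime p} \<times> {2..N})"
        using pk n p2 by (intro image_eqI[of _ _ "(p, k)"]) (auto simp: S_def)
    qed
  qed (auto simp: mangoldt_nonneg)
  also have "\<dots> \<le> (\<Sum>(p,k)\<in>{p \<in> {2..N}. prime p} \<times> {2..N}. ln (real p) * (1 / real p) ^ k)"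
    by (rule order_trans[OF sum_image_le])
       (auto simp: mangoldt_nonneg mangoldt_primepow power_one_over intro!: sum_mono)
  also have "\<dots> = (\<Sum>p | p \<in> {2..N} \<and> prime p. \<Sum>k=2..N. ln (real p) * (1 / real p) ^ k)"
    by (subst sum.Sigma) auto
  also have "\<dots> \<le> (\<Sum>p=2..N. \<Sum>k=2..N. ln (real p) * (1 / real p) ^ k)"
    by (intro sum_mono2 sum_nonneg mult_nonneg_nonneg) auto
  also have "\<dots> \<le> (\<Sum>p=2..N. 4 * (1 / (real p * sqrt (real p))))"
  proof (rule sum_mono)
    fix p assume p: "p \<in> {2..N}"
    define x where "x = 1 / real p"
    have x: "0 < x" "2 * x \<le> 1" using p by (auto simp: x_def field_simps)
    \<comment> \<open>The subtracted term is what makes the induction close; it uses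
      \<open>2 * x \<le> 1\<close>.\<close>
    have "(\<Sum>k=2..m. x ^ k) \<le> 2 * x ^ 2 - 2 * x ^ Suc m" if "m \<ge> 1" for m
      using that
    proof (induction m rule: dec_induct)
      case base
      then show ?case by (simp add: power2_eq_square)
    next
      case (step m)
      have "2 * x * x ^ Suc m \<le> 1 * x ^ Suc m" using x by (intro mult_right_mono) auto
      then show ?case using step by simp
    qed
    from this[of N] have "(\<Sum>k=2..N. x ^ k) \<le> 2 * x ^ 2" using p x by (smt (verit) atLeastAtMost_iff zero_less_power one_le_numeral order_trans)
    then have "(\<Sum>k=2..N. ln (real p) * x ^ k) \<le> ln (real p) * (2 * x ^ 2)"
      using p unfolding sum_distrib_left[symmetric] by (intro mult_left_mono) auto
    also have "\<dots> = 2 * x * (ln (real p) / real p)" by (simp add: x_def power2_eq_square)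
    also have "\<dots> \<le> 2 * x * (2 / sqrt (real p))"
      using p x by (intro mult_left_mono ln_over_self_le_inverse_sqrt) auto
    finally show "(\<Sum>k=2..N. ln (real p) * (1 / real p) ^ k) \<le> 4 * (1 / (real p * sqrt (real p)))"
      by (simp add: x_def)
  qed
  also have "\<dots> = 4 * (\<Sum>p=2..N. 1 / (real p * sqrt (real p)))" by (simp add: sum_distrib_left)
  also have "(\<Sum>p=2..N. 1 / (real p * sqrt (real p))) \<le> 2"
  proof -
    \<comment> \<open>Again a strengthened bound, whose correction \<open>2 / sqrt m\<close>
      telescopes.\<close>
    have "(\<Sum>p=2..m. 1 / (real p * sqrt (real p))) \<le> 2 - 2 / sqrt (real m)" if "m \<ge> 1" for m
      using that
    proof (induction m rule: dec_induct)
      case (step m)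
      define a b where "a = sqrt (real m)" and "b = sqrt (real (Suc m))"
      have ab: "0 < a" "a \<le> b" "b * b - a * a = 1" "real (Suc m) = b * b"
        using step by (auto simp: a_def b_def)
      have "a * 1 = a * ((b - a) * (b + a))" using ab by (simp add: algebra_simps)
      also have "\<dots> \<le> b * ((b - a) * (2 * b))" using ab by (intro mult_mono) auto
      finally have "0 \<le> (b * ((b - a) * (2 * b)) - a) / (a * b * b * b)" using ab by simp
      also have "\<dots> = 2 / a - 2 / b - 1 / (b * b * b)" using ab(1,2) by (simp add: field_simps)
      finally have "1 / (b * b * b) \<le> 2 / a - 2 / b" by simp
      then show ?case using step ab by (simp flip: a_def b_def)
    qed simp
    from this[of N] show ?thesis by (cases "N = 0") (auto intro: order_trans)
  qed
  finally show ?thesis by simp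
qed

section \<open>Primes in residue classes modulo a prime\<close>

lemma sum_Un_nonneg_le:
  fixes f :: "'a \<Rightarrow> real"
  assumes "finite A" "finite B" "\<And>x. f x \<ge> 0"
  shows "sum f (A \<union> B) \<le> sum f A + sum f B"
  using sum.union_inter[OF assms(1,2), of f] sum_nonneg[of "A \<inter> B" f] assms(3) by simp

text \<open>A primitive root \<open>g\<close> turns the unit group into a cyclic one:
  \<open>ind\<close> is the discrete logarithm to base \<open>g\<close>, and the
  \<open>chi k\<close> with \<open>k < q - 1\<close> are all the characters modulo \<open>q\<close>,
  \<open>chi 0\<close> being the principal one.\<close>

locale prime_modulus =
  fixes q g :: nat
  assumes q: "prime q" and g: "residue_primroot q g"
begin

\<comment> \<open>Otherwise \<open>q - 1\<close> turns into \<open>q - Suc 0\<close> and no longer matches the lemmas below.\<close>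
declare One_nat_def [simp del]

definition ind :: "nat \<Rightarrow> nat" where
  "ind n = inv_into {..<q - 1} (\<lambda>i. g ^ i mod q) (n mod q)"

definition \<zeta> :: complex where
  "\<zeta> = cis (2 * pi / real (q - 1))"

definition chi :: "nat \<Rightarrow> nat \<Rightarrow> complex" where
  "chi k n = (if q dvd n then 0 else \<zeta> ^ (k * ind n))"

lemma q_gt_1: "q > 1" using q by (rule prime_gt_1_nat)

lemma generator: "bij_betw (\<lambda>i. g ^ i mod q) {..<q - 1} {0<..<q}"
  using residue_primroot_is_generator[OF q_gt_1 g] q by (simp add: totient_prime totatives_prime)

lemma ind:
  assumes "\<not> q dvd n"
  shows ind_less: "ind n < q - 1" and ind_cong: "g ^ ind n mod q = n mod q"
proof -
  have "n mod q \<in> {0<..<q}" using assms q_gt_1 by (auto simp: mod_greater_zero_iff_not_dvd)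
  then have *: "n mod q \<in> (\<lambda>i. g ^ i mod q) ` {..<q - 1}"
    using generator by (simp add: bij_betw_def)
  show "ind n < q - 1" using inv_into_into[OF *] by (simp add: ind_def)
  show "g ^ ind n mod q = n mod q" using f_inv_into_f[OF *] by (simp add: ind_def)
qed

lemma generator_power_cong_iff: "[g ^ i = g ^ j] (mod q) \<longleftrightarrow> [i = j] (mod (q - 1))"
  using g q order_divides_expdiff[of q g i j] by (simp add: residue_primroot_def totient_prime)

lemma generator_power_eq_iff:
  "i < q - 1 \<Longrightarrow> j < q - 1 \<Longrightarrow> [g ^ i = g ^ j] (mod q) \<longleftrightarrow> i = j"
  unfolding generator_power_cong_iff by (simp add: cong_def)

lemma ind_mult:
  assumes "\<not> q dvd m" "\<not> q dvd n"
  shows "[ind (m * n) = ind m + ind n] (mod (q - 1))"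
proof -
  have "\<not> q dvd m * n" using assms q by (simp add: prime_dvd_mult_iff)
  then have "[g ^ ind (m * n) = m * n] (mod q)" by (simp add: cong_def ind)
  also have "[m * n = g ^ ind m * g ^ ind n] (mod q)"
    using assms by (intro cong_mult) (simp_all add: cong_def ind)
  finally show ?thesis by (simp add: generator_power_cong_iff flip: power_add)
qed

lemma zeta_power_order: "\<zeta> ^ (q - 1) = 1"
  using q_gt_1 by (simp add: \<zeta>_def DeMoivre)

lemma zeta_power_cong: "[i = j] (mod (q - 1)) \<Longrightarrow> \<zeta> ^ i = \<zeta> ^ j"
proof -
  have "\<zeta> ^ i = \<zeta> ^ (i mod (q - 1))" for i
  proof -
    have "\<zeta> ^ i = \<zeta> ^ ((q - 1) * (i div (q - 1)) + i mod (q - 1))" by simp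
    also have "\<dots> = \<zeta> ^ (i mod (q - 1))" by (simp only: power_add power_mult zeta_power_order) simp
    finally show ?thesis .
  qed
  then show "[i = j] (mod (q - 1)) \<Longrightarrow> \<zeta> ^ i = \<zeta> ^ j" by (metis cong_def)
qed

lemma zeta_power_eq_1_iff: "\<zeta> ^ i = 1 \<longleftrightarrow> (q - 1) dvd i"
proof
  assume "(q - 1) dvd i"
  then show "\<zeta> ^ i = 1" using zeta_power_cong[of i 0] by (simp add: cong_0_iff)
next
  assume *: "\<zeta> ^ i = 1"
  define r where "r = i mod (q - 1)"
  have "\<zeta> ^ r = 1" using * zeta_power_cong[of r i] by (simp add: r_def cong_def)
  then have "cis (2 * pi * real r / real (q - 1)) = cis (2 * pi * real 0 / real (q - 1))"
    by (simp add: \<zeta>_def DeMoivre mult_ac)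
  moreover have "r \<in> {..<q - 1}" "0 \<in> {..<q - 1}" using q_gt_1 by (auto simp: r_def)
  ultimately have "r = 0"
    using bij_betw_roots_unity[of "q - 1"] q_gt_1 unfolding bij_betw_def inj_on_def by force
  then show "(q - 1) dvd i" by (auto simp: r_def)
qed

lemma sum_zeta_powers: "(\<Sum>i<q - 1. \<zeta> ^ (i * m)) = (if (q - 1) dvd m then of_nat (q - 1) else 0)"
proof (cases "(q - 1) dvd m")
  case True
  then have "\<zeta> ^ (i * m) = 1" for i by (simp add: zeta_power_eq_1_iff)
  then show ?thesis using True by simp
next
  case False
  then have *: "\<zeta> ^ m \<noteq> 1" by (simp add: zeta_power_eq_1_iff)
  have "(\<Sum>i<q - 1. \<zeta> ^ (i * m)) = (\<Sum>i<q - 1. (\<zeta> ^ m) ^ i)"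
    by (simp add: mult.commute flip: power_mult)
  also have "\<dots> = ((\<zeta> ^ m) ^ (q - 1) - 1) / (\<zeta> ^ m - 1)"
    using * by (rule geometric_sum)
  also have "(\<zeta> ^ m) ^ (q - 1) = (\<zeta> ^ (q - 1)) ^ m" by (simp add: mult.commute flip: power_mult)
  finally show ?thesis using False by (simp add: zeta_power_order)
qed

lemma norm_zeta [simp]: "norm \<zeta> = 1" by (simp add: \<zeta>_def)

lemma chi_mult: "chi k (m * n) = chi k m * chi k n"
proof (cases "q dvd m \<or> q dvd n")
  case False
  have "\<zeta> ^ ind (m * n) = \<zeta> ^ (ind m + ind n)" using False by (intro zeta_power_cong ind_mult) auto
  then have "(\<zeta> ^ ind (m * n)) ^ k = (\<zeta> ^ ind m) ^ k * (\<zeta> ^ ind n) ^ k" by (simp add: power_add power_mult_distrib)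
  then show ?thesis using False q by (simp add: chi_def prime_dvd_mult_iff power_mult mult.commute flip: power_mult)
qed (auto simp: chi_def)

lemma chi_cong:
  assumes "[m = n] (mod q)"
  shows "chi k m = chi k n"
  using assms cong_dvd_iff[OF assms] by (simp add: chi_def ind_def cong_def)

lemma norm_chi_le: "norm (chi k n) \<le> 1"
  by (simp add: chi_def norm_power)

lemma ind_1: "ind 1 = 0"
proof -
  have "[g ^ ind 1 = g ^ 0] (mod q)" using q_gt_1 ind_cong[of 1] by (simp add: cong_def)
  moreover have "ind 1 < q - 1" using q_gt_1 by (intro ind_less) auto
  ultimately show ?thesis using q_gt_1 by (subst (asm) generator_power_eq_iff) auto
qed

text \<open>For these \<open>k\<close> the sum over a full period is a vanishing sum of roots of
  unity, so only an incomplete period of fewer than \<open>q\<close> terms remains.\<close>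

lemma bounded_character_chi:
  assumes "0 < k" "k < q - 1"
  shows "bounded_character (chi k) (real q)"
proof
  show "chi k 1 = 1" using q_gt_1 by (simp add: chi_def ind_1)
  show "chi k (m * n) = chi k m * chi k n" for m n by (rule chi_mult)
  show "norm (chi k n) \<le> 1" for n by (rule norm_chi_le)
  define S where "S N = (\<Sum>n<N. chi k n)" for N
  have "S q = (\<Sum>n\<in>{0<..<q}. chi k n)"
    unfolding S_def by (intro sum.mono_neutral_right) (auto simp: chi_def)
  also have "\<dots> = (\<Sum>i<q - 1. chi k (g ^ i mod q))"
    using sum.reindex_bij_betw[OF generator, of "chi k"] by simp
  also have "\<dots> = (\<Sum>i<q - 1. \<zeta> ^ (i * k))"
  proof (intro sum.cong refl)
    fix i assume i: "i \<in> {..<q - 1}"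
    then have "g ^ i mod q \<in> {0<..<q}" using generator by (auto simp: bij_betw_def)
    then have nd: "\<not> q dvd g ^ i mod q" by (auto dest: dvd_imp_le)
    have "[g ^ ind (g ^ i mod q) = g ^ i] (mod q)" using ind_cong[OF nd] by (simp add: cong_def)
    then have "ind (g ^ i mod q) = i"
      using ind_less[OF nd] i by (subst (asm) generator_power_eq_iff) auto
    then show "chi k (g ^ i mod q) = \<zeta> ^ (i * k)" using nd by (simp add: chi_def mult.commute)
  qed
  also have "\<dots> = 0" using assms unfolding sum_zeta_powers by (auto dest: dvd_imp_le)
  finally have Sq: "S q = 0" .
  have shift: "S (N + q) = S N" for N
  proof (induction N)
    case (Suc N)
    have "chi k (N + q) = chi k N" by (rule chi_cong) (simp add: cong_def)
    with Suc show ?case by (simp add: S_def)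
  qed (simp add: Sq, simp add: S_def)
  have "norm (S N) \<le> real q" for N
  proof (induction N rule: less_induct)
    case (less N)
    show ?case
    proof (cases "N < q")
      case True
      have "norm (S N) \<le> (\<Sum>n<N. 1)" unfolding S_def by (intro sum_norm_le norm_chi_le)
      then show ?thesis using True by simp
    next
      case False
      then show ?thesis using less.IH[of "N - q"] shift[of "N - q"] q_gt_1 by simp
    qed
  qed
  moreover have "(\<Sum>n=1..N. chi k n) = S (Suc N)" for N
    unfolding S_def by (intro sum.mono_neutral_left) (auto simp: chi_def not_le)
  ultimately show "norm (\<Sum>n=1..N. chi k n) \<le> real q" for N by simp
qed

abbreviation K :: "nat \<Rightarrow> nat \<Rightarrow> complex" where
  "K k N \<equiv> \<Sum>n=1..N. chi k n * mangoldt n / of_nat n"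

text \<open>The exponent \<open>q - 1 - ind a\<close> stands for \<open>- ind a\<close> in the
  natural numbers, so the factor is the conjugate of \<open>chi k a\<close>.\<close>

lemma orthogonality:
  assumes a: "\<not> q dvd a"
  shows "(\<Sum>k<q - 1. \<zeta> ^ (k * (q - 1 - ind a)) * chi k n) = (if [n = a] (mod q) then of_nat (q - 1) else 0)"
proof (cases "q dvd n")
  case True
  then have "\<not> [n = a] (mod q)" using a cong_dvd_iff by blast
  then show ?thesis using True by (simp add: chi_def)
next
  case False
  define m where "m = q - 1 - ind a + ind n"
  have "(\<Sum>k<q - 1. \<zeta> ^ (k * (q - 1 - ind a)) * chi k n) = (\<Sum>k<q - 1. \<zeta> ^ (k * m))"
    using False by (intro sum.cong) (simp_all add: chi_def m_def distrib_left flip: power_add)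
  also have "\<dots> = (if (q - 1) dvd m then of_nat (q - 1) else 0)" by (rule sum_zeta_powers)
  also have "(q - 1) dvd m \<longleftrightarrow> [n = a] (mod q)"
  proof -
    have la: "ind a < q - 1" and ln: "ind n < q - 1" using a False by (auto intro: ind_less)
    have "[n = a] (mod q) \<longleftrightarrow> [g ^ ind n = g ^ ind a] (mod q)"
      using ind_cong[OF a] ind_cong[OF False] by (simp add: cong_def)
    also have "\<dots> \<longleftrightarrow> ind n = ind a"
      using ln la by (rule generator_power_eq_iff)
    also have "\<dots> \<longleftrightarrow> (q - 1) dvd m"
    proof
      assume "(q - 1) dvd m"
      then obtain c where c: "m = (q - 1) * c" ..
      have "0 < m" "m < (q - 1) * 2" using la ln by (auto simp: m_def)
      then have "c > 0" "c < 2" unfolding c nat_mult_less_cancel_disj by (auto intro: Nat.gr0I)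
      then have "c = 1" by simp
      then show "ind n = ind a" using c la ln by (simp add: m_def)
    qed (use la in \<open>auto simp: m_def\<close>)
    finally show ?thesis ..
  qed
  finally show ?thesis .
qed

lemma sum_K_eq:
  assumes a: "\<not> q dvd a"
  shows "(\<Sum>k<q - 1. \<zeta> ^ (k * (q - 1 - ind a)) * K k N) =
    of_real (real (q - 1) * (\<Sum>n | n \<in> {1..N} \<and> [n = a] (mod q). mangoldt n / real n))"
proof -
  have "(\<Sum>k<q - 1. \<zeta> ^ (k * (q - 1 - ind a)) * K k N) =
    (\<Sum>n=1..N. (\<Sum>k<q - 1. \<zeta> ^ (k * (q - 1 - ind a)) * chi k n) * (mangoldt n / of_nat n))"
    unfolding sum_distrib_left sum_distrib_right by (subst sum.swap) (simp add: mult_ac)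
  also have "\<dots> = (\<Sum>n=1..N. if [n = a] (mod q) then of_nat (q - 1) * (mangoldt n / of_nat n) else 0)"
    unfolding orthogonality[OF a] by (intro sum.cong) auto
  also have "\<dots> = (\<Sum>n | n \<in> {1..N} \<and> [n = a] (mod q). of_nat (q - 1) * (mangoldt n / of_nat n))"
    by (rule sum.inter_filter[symmetric]) simp
  also have "\<dots> = of_real (real (q - 1) * (\<Sum>n | n \<in> {1..N} \<and> [n = a] (mod q). mangoldt n / real n))"
    by (simp add: sum_distrib_left)
  finally show ?thesis .
qed

text \<open>The principal character omits the multiples of \<open>q\<close>: the prime
  \<open>q\<close> itself costs at most \<open>ln q\<close>, the nonprime ones at most 8, and
  Mertens' lower bound costs 1.\<close>

lemma K_0_bounds:
  assumes "N > 0"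
  shows "ln (real N) - 9 - ln (real q) \<le> Re (K 0 N)" "Re (K 0 N) \<le> ln (real N) + 4"
proof -
  let ?f = "\<lambda>n. mangoldt n / real n"
  have eq: "Re (K 0 N) = (\<Sum>n | n \<in> {1..N} \<and> \<not> q dvd n. ?f n)"
    unfolding Re_sum by (subst sum.inter_filter) (auto simp: chi_def intro!: sum.cong)
  have nonneg: "?f n \<ge> 0" for n by (simp add: mangoldt_nonneg)
  have "Re (K 0 N) \<le> (\<Sum>n=1..N. ?f n)" unfolding eq by (intro sum_mono2) (auto simp: nonneg)
  with mertens_mangoldt(2)[OF assms] show "Re (K 0 N) \<le> ln (real N) + 4" by linarith
  have "(\<Sum>n=1..N. ?f n) = (\<Sum>n\<in>{n \<in> {1..N}. \<not> q dvd n} \<union> {n \<in> {1..N}. q dvd n}. ?f n)"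
    by (intro sum.cong) auto
  also have "\<dots> = Re (K 0 N) + (\<Sum>n | n \<in> {1..N} \<and> q dvd n. ?f n)"
    unfolding eq by (rule sum.union_disjoint) auto
  also have "(\<Sum>n | n \<in> {1..N} \<and> q dvd n. ?f n) \<le> (\<Sum>n\<in>insert q {n \<in> {1..N}. \<not> prime n}. ?f n)"
    using q by (intro sum_mono2) (auto simp: nonneg Suc_le_eq dest: primes_dvd_imp_eq)
  also have "\<dots> \<le> ?f q + (\<Sum>n | n \<in> {1..N} \<and> \<not> prime n. ?f n)"
    using q by (subst sum.insert) (auto simp: sum_nonneg nonneg)
  also have "\<dots> \<le> ln (real q) + 8"
  proof (rule add_mono)
    have "ln (real q) * 1 \<le> ln (real q) * real q" using q_gt_1 by (intro mult_left_mono) auto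
    then show "?f q \<le> ln (real q)" using q q_gt_1 by (simp add: divide_le_eq)
  qed (rule sum_nonprime_mangoldt_bounded)
  finally show "ln (real N) - 9 - ln (real q) \<le> Re (K 0 N)"
    using mertens_mangoldt(1)[OF assms] by linarith
qed

text \<open>Holds whether or not \<open>L(1, chi k)\<close> vanishes, so it can be used before
  nonvanishing is known.\<close>

lemma Re_K_bounded_above:
  assumes "0 < k" "k < q - 1"
  obtains C where "\<And>N. N > 0 \<Longrightarrow> Re (K k N) \<le> C"
proof -
  interpret C: bounded_character "chi k" "real q" by (rule bounded_character_chi[OF assms])
  show ?thesis
  proof (cases "C.L0 = 0")
    case True
    then obtain C where C: "\<And>N. N > 0 \<Longrightarrow> norm (K k N + of_real (ln (real N))) \<le> C"
      using C.K_of_L0_eq_0 by blast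
    have "Re (K k N) \<le> C" if "N > 0" for N
    proof -
      have "Re (K k N) \<le> Re (K k N + of_real (ln (real N)))" using that by simp
      also have "\<dots> \<le> C" using C[OF that] complex_Re_le_cmod order_trans by blast
      finally show ?thesis .
    qed
    then show ?thesis using that by blast
  next
    case False
    then obtain C where C: "\<And>N. norm (K k N) \<le> C" using C.K_bounded by blast
    then show ?thesis using that[of C] complex_Re_le_cmod order_trans by blast
  qed
qed

lemma ln_nat_unbounded: "\<exists>N>0. ln (real N) > X"
proof -
  have "eventually (\<lambda>N. X < ln (real N)) sequentially"
    using filterlim_compose[OF ln_at_top filterlim_real_sequentially] by (simp add: filterlim_at_top_dense)
  then obtain M where "\<And>N. N \<ge> M \<Longrightarrow> X < ln (real N)" by (auto simp: eventually_sequentially)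
  then show ?thesis by (intro exI[of _ "Suc M"]) (auto simp del: of_nat_Suc)
qed

lemma cnj_K:
  assumes "k < q - 1"
  shows "K (q - 1 - k) N = cnj (K k N)"
proof -
  have "chi (q - 1 - k) n = cnj (chi k n)" for n
  proof (cases "q dvd n")
    case False
    have "\<zeta> ^ ((q - 1 - k) * ind n) * \<zeta> ^ (k * ind n) = \<zeta> ^ ((q - 1) * ind n)"
      using assms by (simp flip: power_add distrib_right)
    also have "\<dots> = 1" by (simp add: power_mult zeta_power_order)
    also have "1 = cnj (\<zeta> ^ (k * ind n)) * \<zeta> ^ (k * ind n)"
      using complex_norm_square[of "\<zeta> ^ (k * ind n)"] by (simp add: norm_power mult.commute)
    finally have "\<zeta> ^ ((q - 1 - k) * ind n) = cnj (\<zeta> ^ (k * ind n))"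
      by (metis mult_right_cancel norm_zeta norm_zero power_not_zero zero_neq_one)
    with False show ?thesis by (simp add: chi_def)
  qed (simp add: chi_def)
  moreover have "cnj (mangoldt n) = mangoldt n" for n
    by (metis of_real_mangoldt complex_cnj_complex_of_real)
  ultimately show ?thesis by simp
qed

text \<open>
  If \<open>L(1, chi k)\<close> vanishes for a non-real character, then so does its conjugate, and the sum of
  all \<open>K k N\<close>, which is nonnegative by orthogonality, would be at most \<open>- ln N + O(1)\<close>.
\<close>

lemma L0_chi_nonzero:
  assumes k: "0 < k" "k < q - 1"
  shows "bounded_character.L0 (chi k) (real q) \<noteq> 0"
proof -
  interpret C: bounded_character "chi k" "real q" by (rule bounded_character_chi[OF k])
  show ?thesis
  \<comment> \<open>The index \<open>(q - 1) / 2\<close> belongs to the quadratic character. In the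
    other case \<open>k\<close> and its conjugate index \<open>q - 1 - k\<close> are
    distinct.\<close>
  proof (cases "2 * k = q - 1")
    case True
    show ?thesis
    proof (rule C.L0_nonzero_of_real)
      fix n
      have "(\<zeta> ^ (k * ind n)) ^ 2 = (\<zeta> ^ (2 * k)) ^ ind n"
        by (simp add: mult_ac flip: power_mult)
      also have "\<dots> = 1" by (simp only: True zeta_power_order power_one)
      finally show "chi k n \<in> {-1, 0, 1}" by (auto simp: chi_def power2_eq_1_iff)
    qed
  next
    case False
    show ?thesis
    proof
      assume "C.L0 = 0"
      then obtain C where C: "\<And>N. N > 0 \<Longrightarrow> norm (K k N + of_real (ln (real N))) \<le> C"
        using C.K_of_L0_eq_0 by blast
      have KC: "Re (K k N) \<le> C - ln (real N)" if "N > 0" for N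
        using order_trans[OF complex_Re_le_cmod C[OF that]] by simp
      have "\<exists>C. \<forall>N>0. Re (K j N) \<le> C" if "j \<in> {0<..<q - 1}" for j
        using Re_K_bounded_above[of j] that by (metis greaterThanLessThan_iff)
      then obtain D where D: "\<And>j N. j \<in> {0<..<q - 1} \<Longrightarrow> N > 0 \<Longrightarrow> Re (K j N) \<le> D j"
        by metis
      define k' where "k' = q - 1 - k"
      have k': "0 < k'" "k' < q - 1" "k' \<noteq> k" using k False by (auto simp: k'_def)
      define J where "J = {..<q - 1} - {0, k, k'}"
      \<comment> \<open>Index 0 contributes at most \<open>ln N + 4\<close>, the two conjugate
        indices at most \<open>C - ln N\<close> each, and all others are bounded above.\<close>
      have "ln (real N) \<le> 4 + 2 * C + (\<Sum>j\<in>J. D j)" if N: "N > 0" for N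
      proof -
        have q1: "\<not> q dvd 1" using q_gt_1 by simp
        have "\<zeta> ^ (j * (q - 1 - ind 1)) = 1" for j by (simp add: ind_1 zeta_power_eq_1_iff)
        then have "(\<Sum>j<q - 1. K j N) = (\<Sum>j<q - 1. \<zeta> ^ (j * (q - 1 - ind 1)) * K j N)" by simp
        also have "\<dots> = of_real (real (q - 1) * (\<Sum>n | n \<in> {1..N} \<and> [n = 1] (mod q). mangoldt n / real n))"
          by (rule sum_K_eq[OF q1])
        finally have "Re (\<Sum>j<q - 1. K j N) = real (q - 1) * (\<Sum>n | n \<in> {1..N} \<and> [n = 1] (mod q). mangoldt n / real n)"
          by (simp only: Re_complex_of_real)
        moreover have "0 \<le> real (q - 1) * (\<Sum>n | n \<in> {1..N} \<and> [n = 1] (mod q). mangoldt n / real n)"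
          by (intro mult_nonneg_nonneg sum_nonneg) (auto simp: mangoldt_nonneg)
        ultimately have "0 \<le> (\<Sum>j<q - 1. Re (K j N))" by (simp only: Re_sum)
        also have "{..<q - 1} = insert 0 (insert k (insert k' J))"
          using k k' by (auto simp: J_def)
        also have "(\<Sum>j\<in>\<dots>. Re (K j N)) = Re (K 0 N) + Re (K k N) + Re (K k' N) + (\<Sum>j\<in>J. Re (K j N))"
          using k k' by (subst sum.insert; (simp add: J_def)?)+
        also have "Re (K k' N) = Re (K k N)" unfolding k'_def using cnj_K[OF k(2), of N] by (simp only: cnj.sel)
        also have "(\<Sum>j\<in>J. Re (K j N)) \<le> (\<Sum>j\<in>J. D j)"
          using N by (intro sum_mono D) (auto simp: J_def)
        finally show ?thesis using KC[OF N] K_0_bounds(2)[OF N] by linarith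
      qed
      moreover obtain N where "N > 0" "ln (real N) > 4 + 2 * C + (\<Sum>j\<in>J. D j)"
        using ln_nat_unbounded by blast
      ultimately show False by (meson not_less)
    qed
  qed
qed

text \<open>In the orthogonality relation the principal character supplies \<open>ln N\<close>; all
  other characters are bounded since their \<open>L0\<close> is nonzero.\<close>

lemma sum_mangoldt_progression_lower_bound:
  assumes a: "\<not> q dvd a"
  obtains C where "\<And>N. N > 0 \<Longrightarrow>
    ln (real N) - C \<le> real (q - 1) * (\<Sum>n | n \<in> {1..N} \<and> [n = a] (mod q). mangoldt n / real n)"
proof -
  have "\<exists>C. \<forall>N. norm (K k N) \<le> C" if "k \<in> {0<..<q - 1}" for k
  proof -
    have k: "0 < k" "k < q - 1" using that by auto
    interpret C: bounded_character "chi k" "real q" by (rule bounded_character_chi[OF k])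
    show ?thesis using C.K_bounded[OF L0_chi_nonzero[OF k]] by metis
  qed
  then obtain D where D: "\<And>k N. k \<in> {0<..<q - 1} \<Longrightarrow> norm (K k N) \<le> D k" by metis
  let ?z = "\<lambda>k. \<zeta> ^ (k * (q - 1 - ind a))"
  have "ln (real N) - (9 + ln (real q) + (\<Sum>k\<in>{0<..<q - 1}. D k)) \<le>
      real (q - 1) * (\<Sum>n | n \<in> {1..N} \<and> [n = a] (mod q). mangoldt n / real n)" if N: "N > 0" for N
  proof -
    have "real (q - 1) * (\<Sum>n | n \<in> {1..N} \<and> [n = a] (mod q). mangoldt n / real n) =
          Re (\<Sum>k<q - 1. ?z k * K k N)" by (simp only: sum_K_eq[OF a] Re_complex_of_real)
    also have "{..<q - 1} = insert 0 {0<..<q - 1}" using q_gt_1 by auto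
    also have "Re (\<Sum>k\<in>\<dots>. ?z k * K k N) = Re (K 0 N) + (\<Sum>k\<in>{0<..<q - 1}. Re (?z k * K k N))"
      by (subst sum.insert) (auto simp: Re_sum)
    finally have eq: "real (q - 1) * (\<Sum>n | n \<in> {1..N} \<and> [n = a] (mod q). mangoldt n / real n) =
      Re (K 0 N) + (\<Sum>k\<in>{0<..<q - 1}. Re (?z k * K k N))" .
    have "(\<Sum>k\<in>{0<..<q - 1}. - D k) \<le> (\<Sum>k\<in>{0<..<q - 1}. Re (?z k * K k N))"
    proof (rule sum_mono)
      fix k assume k: "k \<in> {0<..<q - 1}"
      have "\<bar>Re (?z k * K k N)\<bar> \<le> norm (?z k * K k N)" by (rule abs_Re_le_cmod)
      also have "\<dots> \<le> D k" using D[OF k, of N] by (simp only: norm_mult norm_power norm_zeta power_one mult_1)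
      finally show "- D k \<le> Re (?z k * K k N)" by linarith
    qed
    then show ?thesis unfolding eq sum_negf using K_0_bounds(1)[OF N] by linarith
  qed
  then show ?thesis using that by blast
qed

end

text \<open>A convergent reciprocal sum would have a small tail; weighting by
  \<open>ln p \<le> ln N\<close> then bounds the von Mangoldt sum over the class by a small multiple
  of \<open>ln N\<close>, below the known growth. The finite set \<open>F\<close> is the form in
  which the second moment argument uses divergence.\<close>

theorem sum_prime_reciprocals_progression_unbounded:
  fixes q a z :: nat and X :: real
  assumes q: "prime q" and a: "\<not> q dvd a"
  shows "\<exists>F. finite F \<and> (\<forall>p\<in>F. prime p \<and> [p = a] (mod q) \<and> p > z) \<and> X \<le> (\<Sum>p\<in>F. 1 / real p)"
proof (rule ccontr)
  assume *: "\<not> ?thesis"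
  have F: "(\<Sum>p\<in>F. 1 / real p) \<le> X"
    if "finite F" "\<And>p. p \<in> F \<Longrightarrow> prime p \<and> [p = a] (mod q) \<and> p > z" for F
    using that * by (meson linear)
  obtain g where "residue_primroot q g"
    using prime_primitive_root_exists[of q] q prime_gt_1_nat[OF q] by auto
  then interpret prime_modulus q g using q by unfold_locales
  obtain C where C: "\<And>N. N > 0 \<Longrightarrow>
    ln (real N) - C \<le> real (q - 1) * (\<Sum>n | n \<in> {1..N} \<and> [n = a] (mod q). mangoldt n / real n)"
    using sum_mangoldt_progression_lower_bound[OF a] by blast
  define P where "P p \<longleftrightarrow> prime p \<and> [p = a] (mod q) \<and> p > z" for p
  define f where "f p = (if P p then 1 / real p else 0)" for p
  define r where "r = real (q - 1)"
  have r: "r > 0" using q_gt_1 by (simp add: r_def)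
  have "summable f"
  proof (rule summableI_nonneg_bounded)
    fix n
    have "(\<Sum>p<n. f p) = (\<Sum>p | p \<in> {..<n} \<and> P p. 1 / real p)"
      unfolding f_def by (rule sum.inter_filter[symmetric]) simp
    also have "\<dots> \<le> X" by (rule F) (auto simp: P_def)
    finally show "(\<Sum>p<n. f p) \<le> X" .
  qed (simp add: f_def)
  \<comment> \<open>The sum over the class grows at least like \<open>ln N / r\<close>; a tail below
    \<open>1 / (2 * r)\<close> accounts for only half of that.\<close>
  then obtain m where m: "\<And>n. norm (sum f {m..<n}) < 1 / (2 * r)"
    using r unfolding summable_Cauchy by (meson divide_pos_pos mult_pos_pos order_refl zero_less_numeral zero_less_one)
  define w where "w = max m (Suc z)"
  have bound: "ln (real N) \<le> 2 * (C + r * (8 + (\<Sum>n=1..w. mangoldt n / real n)))" if N: "N > 0" for N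
  proof -
    define A where "A = {n \<in> {1..N}. [n = a] (mod q)}"
    have "(\<Sum>n\<in>A. mangoldt n / real n) \<le>
      (\<Sum>n\<in>{n \<in> {1..N}. \<not> prime n} \<union> ({1..w} \<union> {n \<in> {m..<Suc N}. P n}). mangoldt n / real n)"
      by (intro sum_mono2) (auto simp: A_def P_def w_def mangoldt_nonneg)
    also have "\<dots> \<le> (\<Sum>n | n \<in> {1..N} \<and> \<not> prime n. mangoldt n / real n) +
       ((\<Sum>n=1..w. mangoldt n / real n) + (\<Sum>n | n \<in> {m..<Suc N} \<and> P n. mangoldt n / real n))"
      by (intro order_trans[OF sum_Un_nonneg_le] add_mono order_refl) (auto simp: mangoldt_nonneg)
    also have "(\<Sum>n | n \<in> {m..<Suc N} \<and> P n. mangoldt n / real n) \<le> (\<Sum>n | n \<in> {m..<Suc N} \<and> P n. ln (real N) * (1 / real n))"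
    proof (rule sum_mono)
      fix n assume "n \<in> {n \<in> {m..<Suc N}. P n}"
      then have n: "prime n" "n \<le> N" by (auto simp: P_def)
      then have "mangoldt n \<le> ln (real N)" using prime_gt_0_nat[of n] by simp
      then show "mangoldt n / real n \<le> ln (real N) * (1 / real n)" by (simp add: divide_right_mono)
    qed
    also have "\<dots> = ln (real N) * (\<Sum>n\<in>{m..<Suc N}. f n)"
      unfolding f_def by (subst sum.inter_filter[symmetric]) (simp_all add: sum_distrib_left)
    also have "\<dots> \<le> ln (real N) * (1 / (2 * r))"
      using m[of "Suc N"] N by (intro mult_left_mono) auto
    finally have "r * (\<Sum>n\<in>A. mangoldt n / real n) \<le>
        r * (8 + ((\<Sum>n=1..w. mangoldt n / real n) + ln (real N) * (1 / (2 * r))))"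
      using r sum_nonprime_mangoldt_bounded[of N] by (intro mult_left_mono) auto
    also have "\<dots> = r * (8 + (\<Sum>n=1..w. mangoldt n / real n)) + ln (real N) / 2"
      using r by (simp add: distrib_left)
    finally show ?thesis using C[OF N] unfolding A_def r_def by (simp add: algebra_simps)
  qed
  obtain N where "N > 0" "ln (real N) > 2 * (C + r * (8 + (\<Sum>n=1..w. mangoldt n / real n)))"
    using ln_nat_unbounded by blast
  with bound show False by (meson not_less)
qed

section \<open>Sparse sets and persistence of small primes\<close>

text \<open>Upper density at most \<open>e\<close>, as an inequality at every \<open>N\<close> with
  an additive constant. Unions then simply add the parameters, and finite counting errors disappear
  in \<open>C\<close>.\<close>

definition sparse :: "nat set \<Rightarrow> real \<Rightarrow> bool" where
  "sparse A e \<longleftrightarrow> (\<exists>C. \<forall>N. real (card (A \<inter> {1..N})) \<le> e * real N + C)"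

lemma sparseI: "(\<And>N. real (card (A \<inter> {1..N})) \<le> e * real N + C) \<Longrightarrow> sparse A e"
  unfolding sparse_def by blast

lemma sparse_mono:
  assumes "sparse B e" "A \<inter> {1..} \<subseteq> B" "e \<le> e'"
  shows "sparse A e'"
proof -
  obtain C where C: "\<And>N. real (card (B \<inter> {1..N})) \<le> e * real N + C"
    using assms(1) unfolding sparse_def by blast
  show ?thesis
  proof (rule sparseI)
    fix N
    have "card (A \<inter> {1..N}) \<le> card (B \<inter> {1..N})" using assms(2) by (intro card_mono) auto
    then have "real (card (A \<inter> {1..N})) \<le> e * real N + C" using C[of N] by linarith
    also have "\<dots> \<le> e' * real N + C" using assms(3) by (intro add_right_mono mult_right_mono) auto
    finally show "real (card (A \<inter> {1..N})) \<le> e' * real N + C" .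
  qed
qed

lemma sparse_Un:
  assumes "sparse A a" "sparse B b"
  shows "sparse (A \<union> B) (a + b)"
proof -
  obtain C D where C: "\<And>N. real (card (A \<inter> {1..N})) \<le> a * real N + C"
    and D: "\<And>N. real (card (B \<inter> {1..N})) \<le> b * real N + D"
    using assms unfolding sparse_def by blast
  show ?thesis
  proof (rule sparseI)
    fix N
    have "card ((A \<union> B) \<inter> {1..N}) \<le> card (A \<inter> {1..N}) + card (B \<inter> {1..N})"
      using card_Un_le[of "A \<inter> {1..N}" "B \<inter> {1..N}"] by (simp add: Int_Un_distrib2)
    then show "real (card ((A \<union> B) \<inter> {1..N})) \<le> (a + b) * real N + (C + D)"
      using C[of N] D[of N] by (simp add: distrib_right)
  qed
qed

lemma sparse_UN:
  assumes "finite I" "\<And>i. i \<in> I \<Longrightarrow> sparse (A i) e"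
  shows "sparse (\<Union>i\<in>I. A i) (real (card I) * e)"
  using assms
proof (induction I rule: finite_induct)
  case empty
  show ?case by (rule sparseI[where C = 0]) simp
next
  case (insert i I)
  then have "sparse (A i \<union> (\<Union>i\<in>I. A i)) (e + real (card I) * e)" by (intro sparse_Un) auto
  then show ?case using insert by (simp add: distrib_right)
qed

section \<open>Integers without a prime divisor in a given finite set\<close>

lemma card_multiples:
  assumes "d > 0"
  shows "card {n \<in> {1..N}. d dvd n} = N div d"
proof -
  have "{n \<in> {1..N}. d dvd n} = (\<lambda>k. d * k) ` {1..N div d}"
    using assms by (auto simp: less_eq_div_iff_mult_less_eq Suc_le_eq mult.commute elim!: dvdE intro: Nat.gr0I)
  then show ?thesis using assms by (simp add: card_image inj_on_def)
qed

text \<open>Chebyshev's inequality for the number of prime factors in \<open>F\<close>, with mean and variance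
  about \<open>A\<close>.\<close>

lemma sparse_no_prime_divisor_in:
  assumes fin: "finite F" and prime: "\<And>p. p \<in> F \<Longrightarrow> prime p"
    and A_def: "A = (\<Sum>p\<in>F. 1 / real p)" and A: "A > 0"
  shows "sparse {n. \<forall>p\<in>F. \<not> p dvd n} (1 / A)"
proof (rule sparseI)
  fix N :: nat
  define w where "w n = (\<Sum>p\<in>F. if p dvd n then 1 else (0::real))" for n
  define Z where "Z = {n. \<forall>p\<in>F. \<not> p dvd n} \<inter> {1..N}"
  have pos: "p > 0" if "p \<in> F" for p using prime[OF that] by (rule prime_gt_0_nat)
  have count: "(\<Sum>n=1..N. if P n then 1 else (0::real)) = real (card {n \<in> {1..N}. P n})" for P
    by (simp flip: sum.inter_filter)
  have "(\<Sum>n=1..N. w n) = (\<Sum>p\<in>F. real (N div p))"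
    unfolding w_def by (subst sum.swap) (auto simp only: count card_multiples pos intro!: sum.cong)
  also have "\<dots> \<ge> (\<Sum>p\<in>F. real N * (1 / real p) - 1)"
  proof (rule sum_mono)
    fix p assume "p \<in> F"
    then have "real N / real p \<le> real (Suc (N div p))" using pos real_divide_le_Suc_div by blast
    then show "real N * (1 / real p) - 1 \<le> real (N div p)"
      by simp
  qed
  finally have w1: "real N * A - real (card F) \<le> (\<Sum>n=1..N. w n)"
    by (simp only: A_def sum_subtractf flip: sum_distrib_left) simp
  have "(\<Sum>n=1..N. (w n)^2) = (\<Sum>n=1..N. \<Sum>p\<in>F. \<Sum>r\<in>F. if p dvd n \<and> r dvd n then 1 else 0)"
    unfolding w_def power2_eq_square sum_product by (intro sum.cong) auto
  also have "\<dots> = (\<Sum>p\<in>F. \<Sum>n=1..N. \<Sum>r\<in>F. if p dvd n \<and> r dvd n then 1 else 0)"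
    by (rule sum.swap)
  also have "\<dots> = (\<Sum>p\<in>F. \<Sum>r\<in>F. \<Sum>n=1..N. if p dvd n \<and> r dvd n then 1 else 0)"
    by (intro sum.cong refl sum.swap)
  also have "\<dots> = (\<Sum>p\<in>F. \<Sum>r\<in>F. real (card {n \<in> {1..N}. p dvd n \<and> r dvd n}))"
    by (simp only: count)
  \<comment> \<open>Distinct primes divide independently up to rounding; the diagonal gets an extra
    \<open>1 / p\<close>, and keeping the product term there too makes the double sum
    factor.\<close>
  also have "\<dots> \<le> (\<Sum>p\<in>F. \<Sum>r\<in>F. real N * ((1 / real p) * (1 / real r) + (if r = p then 1 / real p else 0)))"
  proof (intro sum_mono)
    fix p r assume pr: "p \<in> F" "r \<in> F"
    show "real (card {n \<in> {1..N}. p dvd n \<and> r dvd n}) \<le>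
      real N * ((1 / real p) * (1 / real r) + (if r = p then 1 / real p else 0))"
    proof (cases "r = p")
      case True
      have "real (N div p) \<le> real N * (1 / real p)" using of_nat_div_le_of_nat[of N p, where ?'a = real] by simp
      also have "\<dots> \<le> real N * ((1 / real p) * (1 / real r) + 1 / real p)" by (intro mult_left_mono) auto
      finally show ?thesis using True card_multiples[OF pos[OF pr(1)], of N] by simp
    next
      case False
      have "coprime p r" using prime[OF pr(1)] prime[OF pr(2)] False by (simp add: primes_coprime)
      then have "{n \<in> {1..N}. p dvd n \<and> r dvd n} = {n \<in> {1..N}. p * r dvd n}"
        by (auto intro: divides_mult dest: dvd_mult_left dvd_mult_right)
      then have "real (card {n \<in> {1..N}. p dvd n \<and> r dvd n}) = real (N div (p * r))"
        by (simp only: card_multiples[OF mult_pos_pos[OF pos[OF pr(1)] pos[OF pr(2)]]])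
      also have "\<dots> \<le> real N / real (p * r)" by (rule of_nat_div_le_of_nat)
      finally show ?thesis using False by simp
    qed
  qed
  also have "\<dots> = (\<Sum>p\<in>F. real N * (A * (1 / real p) + 1 / real p))"
  proof (intro sum.cong refl)
    fix p assume "p \<in> F"
    then have "(\<Sum>r\<in>F. if r = p then 1 / real p else 0) = 1 / real p" using fin by simp
    then show "(\<Sum>r\<in>F. real N * ((1 / real p) * (1 / real r) + (if r = p then 1 / real p else 0))) =
      real N * (A * (1 / real p) + 1 / real p)"
      unfolding A_def sum_distrib_left[symmetric] sum.distrib by (simp only: mult.commute)
  qed
  also have "\<dots> = real N * (A * A + A)"
    by (simp only: A_def sum.distrib flip: sum_distrib_left)
  finally have w2: "(\<Sum>n=1..N. (w n)^2) \<le> real N * (A * A + A)" .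
  \<comment> \<open>Every \<open>n\<close> in \<open>Z\<close> has \<open>w n = 0\<close> and so
    deviates from the mean by \<open>A\<close>.\<close>
  have "A^2 * real (card Z) = (\<Sum>n\<in>Z. (w n - A)^2)"
    by (simp add: Z_def w_def)
  also have "\<dots> \<le> (\<Sum>n=1..N. (w n - A)^2)"
    by (rule sum_mono2) (auto simp: Z_def)
  also have "\<dots> = (\<Sum>n=1..N. (w n)^2) - 2 * A * (\<Sum>n=1..N. w n) + real N * A^2"
    by (simp add: power2_diff sum.distrib sum_subtractf sum_distrib_left mult_ac)
  also have "\<dots> \<le> real N * (A * A + A) - 2 * A * (real N * A - real (card F)) + real N * A^2"
    using A by (intro add_mono diff_mono mult_left_mono w1 w2) auto
  also have "\<dots> = A * (real N + 2 * real (card F))" by (simp add: algebra_simps power2_eq_square)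
  finally have "A * (A * real (card Z)) \<le> A * (real N + 2 * real (card F))"
    by (simp add: power2_eq_square mult.assoc)
  then have "A * real (card Z) \<le> real N + 2 * real (card F)" using A by simp
  then show "real (card Z) \<le> 1 / A * real N + 2 * real (card F) / A"
    using A by (simp add: field_simps)
qed

text \<open>Writing \<open>n\<close> as \<open>k\<close> times its radical, \<open>T n + n\<close>
  is \<open>k\<close> times the product of all \<open>p + 1\<close>.\<close>

lemma dvd_T:
  assumes q: "q dvd n" and p: "prime p" "p dvd n" "q dvd p + 1"
  shows "q dvd T n"
proof (cases "n = 0")
  case True
  then show ?thesis by (simp add: T_def dedekind_psi_def)
next
  case False
  define P where "P = \<Prod>(prime_factors n)"
  obtain k where k: "n = P * k"
    using prod_prime_factors_dvd[of n] False unfolding P_def by (auto elim: dvdE)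
  have pos: "r > 0" if "r \<in> prime_factors n" for r
    using that by (simp add: in_prime_factors_iff prime_gt_0_nat)
  have "real P * (\<Prod>p\<in>prime_factors n. 1 + 1 / real p) = (\<Prod>p\<in>prime_factors n. real p * (1 + 1 / real p))"
    by (simp add: P_def prod.distrib)
  also have "\<dots> = (\<Prod>p\<in>prime_factors n. real (p + 1))"
    using pos by (intro prod.cong) (auto simp: field_simps)
  finally have "dedekind_psi n = real (k * (\<Prod>p\<in>prime_factors n. p + 1))"
    unfolding dedekind_psi_def by (subst (1) k) (simp add: mult.assoc mult.left_commute)
  then have "real (T n + n) = real (k * (\<Prod>p\<in>prime_factors n. p + 1))" by (simp add: of_nat_T)
  then have eq: "T n + n = k * (\<Prod>p\<in>prime_factors n. p + 1)" by (simp only: of_nat_eq_iff)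
  have "p + 1 dvd (\<Prod>p\<in>prime_factors n. p + 1)"
    using p False by (intro dvd_prodI) (auto simp: in_prime_factors_iff)
  then have "q dvd T n + n" unfolding eq using p by (meson dvd_mult dvd_trans)
  with q show ?thesis by (simp add: dvd_add_left_iff)
qed

text \<open>For each prime \<open>q \<le> y\<close> a finite set of primes congruent to
  \<open>q - 1\<close> with large reciprocal sum is hit by most \<open>n\<close>; \<open>y'\<close>
  bounds all these sets at once.\<close>

lemma sparse_missing_shifted_prime:
  assumes "e > 0"
  shows "\<exists>y'. sparse {n. \<exists>q\<le>y. prime q \<and> (\<forall>p\<le>y'. prime p \<and> p dvd n \<longrightarrow> \<not> q dvd p + 1)} e"
proof -
  define I where "I = {q. prime q \<and> q \<le> y}"
  \<comment> \<open>The union over \<open>I\<close> costs \<open>card I / X\<close>, which is at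
    most \<open>e\<close>; the added 1 keeps \<open>X\<close> positive when \<open>I\<close> is
    empty.\<close>
  define X where "X = (real (card I) + 1) / e"
  have X: "X > 0" using assms by (simp add: X_def)
  have I: "finite I" by (simp add: I_def)
  have "\<exists>F. finite F \<and> (\<forall>p\<in>F. prime p \<and> q dvd p + 1) \<and> X \<le> (\<Sum>p\<in>F. 1 / real p)" if "q \<in> I" for q
  proof -
    have q: "prime q" "q > 1" using that prime_gt_1_nat by (auto simp: I_def)
    have "\<not> q dvd q - 1" using q by (auto dest: dvd_imp_le)
    with sum_prime_reciprocals_progression_unbounded[OF q(1), of "q - 1" 0 X]
    obtain F where F: "finite F" "\<forall>p\<in>F. prime p \<and> [p = q - 1] (mod q)" "X \<le> (\<Sum>p\<in>F. 1 / real p)"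
      by blast
    have "q dvd p + 1" if "[p = q - 1] (mod q)" for p
      using cong_add[OF that cong_refl[of 1 q]] q by (simp add: cong_0_iff[symmetric] cong_def)
    with F show ?thesis by blast
  qed
  then obtain F where F: "\<And>q. q \<in> I \<Longrightarrow> finite (F q)"
    "\<And>q p. q \<in> I \<Longrightarrow> p \<in> F q \<Longrightarrow> prime p \<and> q dvd p + 1"
    "\<And>q. q \<in> I \<Longrightarrow> X \<le> (\<Sum>p\<in>F q. 1 / real p)"
    by metis
  define G where "G = (\<Union>q\<in>I. F q)"
  have G: "finite G" using I F by (auto simp: G_def)
  define y' where "y' = Max (insert 0 G)"
  have y': "p \<le> y'" if "q \<in> I" "p \<in> F q" for p q
    using that G unfolding y'_def by (intro Max_ge) (auto simp: G_def)
  have "sparse {n. \<forall>p\<in>F q. \<not> p dvd n} (1 / X)" if "q \<in> I" for q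
  proof -
    define A where "A = (\<Sum>p\<in>F q. 1 / real p)"
    have XA: "X \<le> A" using F(3)[OF that] by (simp add: A_def)
    have "sparse {n. \<forall>p\<in>F q. \<not> p dvd n} (1 / A)"
      by (rule sparse_no_prime_divisor_in[OF F(1)[OF that] _ A_def]) (use F(2)[OF that] XA X in auto)
    then show ?thesis by (rule sparse_mono) (use XA X in \<open>auto intro: divide_left_mono\<close>)
  qed
  then have "sparse (\<Union>q\<in>I. {n. \<forall>p\<in>F q. \<not> p dvd n}) (real (card I) * (1 / X))"
    by (rule sparse_UN[OF I])
  then have "sparse {n. \<exists>q\<le>y. prime q \<and> (\<forall>p\<le>y'. prime p \<and> p dvd n \<longrightarrow> \<not> q dvd p + 1)} e"
  proof (rule sparse_mono)
    show "{n. \<exists>q\<le>y. prime q \<and> (\<forall>p\<le>y'. prime p \<and> p dvd n \<longrightarrow> \<not> q dvd p + 1)} \<inter> {1..} \<subseteq>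
      (\<Union>q\<in>I. {n. \<forall>p\<in>F q. \<not> p dvd n})"
    proof
      fix n assume "n \<in> {n. \<exists>q\<le>y. prime q \<and> (\<forall>p\<le>y'. prime p \<and> p dvd n \<longrightarrow> \<not> q dvd p + 1)} \<inter> {1..}"
      then obtain q where q: "q \<in> I" "\<And>p. p \<le> y' \<Longrightarrow> prime p \<Longrightarrow> p dvd n \<Longrightarrow> \<not> q dvd p + 1"
        unfolding I_def by blast
      then have "\<forall>p\<in>F q. \<not> p dvd n" using F(2)[OF q(1)] y'[OF q(1)] by blast
      with q(1) show "n \<in> (\<Union>q\<in>I. {n. \<forall>p\<in>F q. \<not> p dvd n})" by blast
    qed
    have "real (card I) * (1 / X) = e * (real (card I) / (real (card I) + 1))"
      using assms by (simp add: X_def)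
    also have "\<dots> \<le> e * 1" using assms by (intro mult_left_mono) auto
    finally show "real (card I) * (1 / X) \<le> e" by simp
  qed
  then show ?thesis ..
qed

text \<open>To pass \<open>q\<close> on at the last step, its witness \<open>p \<le> y'\<close> with
  \<open>q dvd p + 1\<close> must still divide the \<open>l\<close>-th iterate. So the induction
  hypothesis is applied with the larger bound \<open>max y y'\<close>, and all conditions stay on
  \<open>n\<close> itself.\<close>

lemma small_primes_persist:
  assumes "e > 0"
  shows "\<exists>E. sparse E e \<and> (\<forall>n. n \<notin> E \<longrightarrow> (\<forall>j\<le>l. \<forall>q\<le>y. prime q \<and> q dvd n \<longrightarrow> q dvd (T ^^ j) n))"
  using assms
proof (induction l arbitrary: y e)
  case 0
  have "sparse {} e" using 0 by (intro sparseI[where C = 0]) simp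
  then show ?case by (intro exI[of _ "{}"]) auto
next
  case (Suc l)
  obtain y' where y': "sparse {n. \<exists>q\<le>y. prime q \<and> (\<forall>p\<le>y'. prime p \<and> p dvd n \<longrightarrow> \<not> q dvd p + 1)} (e / 2)"
    (is "sparse ?D _")
    using sparse_missing_shifted_prime[of "e / 2" y] Suc.prems by auto
  obtain E where E: "sparse E (e / 2)"
    "\<And>n j q. n \<notin> E \<Longrightarrow> j \<le> l \<Longrightarrow> q \<le> max y y' \<Longrightarrow> prime q \<Longrightarrow> q dvd n \<Longrightarrow> q dvd (T ^^ j) n"
    using Suc.IH[of "e / 2" "max y y'"] Suc.prems by auto
  have "q dvd (T ^^ j) n" if n: "n \<notin> E \<union> ?D" and j: "j \<le> Suc l" and q: "q \<le> y" "prime q" "q dvd n" for n j q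
  proof (cases "j \<le> l")
    case True
    then show ?thesis using E(2) n q by auto
  next
    case False
    then have j: "j = Suc l" using j by simp
    obtain p where p: "p \<le> y'" "prime p" "p dvd n" "q dvd p + 1" using n q by auto
    have "q dvd T ((T ^^ l) n)"
      using E(2)[of n l] n p q by (intro dvd_T[of q _ p]) auto
    then show ?thesis by (simp add: j)
  qed
  moreover have "sparse (E \<union> ?D) e" using sparse_Un[OF E(1) y'] by simp
  ultimately show ?case by blast
qed

section \<open>The distribution of the ratio and the theorem\<close>

definition psi_ratio :: "nat \<Rightarrow> real" where
  "psi_ratio n = (\<Prod>p\<in>prime_factors n. 1 + 1 / real p)"

definition psi_ratio_upto :: "nat \<Rightarrow> nat \<Rightarrow> real" where
  "psi_ratio_upto y n = (\<Prod>p | p \<in> prime_factors n \<and> p \<le> y. 1 + 1 / real p)"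

lemma T_eq_psi_ratio: "real (T n) = real n * (psi_ratio n - 1)"
  by (simp add: of_nat_T dedekind_psi_def psi_ratio_def algebra_simps)

section \<open>Sparse exceptional sets for the ratio\<close>

lemma sum_inverse_squares_tail:
  assumes "z > 0"
  shows "(\<Sum>d=Suc z..N. 1 / (real d)\<^sup>2) \<le> 1 / real z"
proof -
  have "(\<Sum>d=Suc z..N. 1 / (real d)\<^sup>2) \<le> 1 / real z - 1 / real N" if "N \<ge> z" for N
    using that
  proof (induction N rule: dec_induct)
    case (step N)
    have "1 / (real (Suc N))\<^sup>2 \<le> 1 / (real N * real (Suc N))"
      using assms step unfolding power2_eq_square by (intro divide_left_mono mult_right_mono) auto
    also have "\<dots> = 1 / real N - 1 / real (Suc N)" using assms step by (simp add: field_simps)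
    finally show ?case using step by simp
  qed simp
  from this[of N] show ?thesis
    by (cases "N \<ge> z") (auto intro: order_trans)
qed

text \<open>Outside this set a prime above \<open>z\<close> that divides \<open>n\<close> divides it
  exactly once.\<close>

lemma sparse_square_divisor:
  assumes "z > 0"
  shows "sparse {n. \<exists>p>z. p^2 dvd n} (1 / real z)"
proof (rule sparseI)
  fix N :: nat
  have "{n. \<exists>p>z. p^2 dvd n} \<inter> {1..N} \<subseteq> (\<Union>d\<in>{Suc z..N}. {n \<in> {1..N}. d^2 dvd n})"
  proof
    fix n assume "n \<in> {n. \<exists>p>z. p^2 dvd n} \<inter> {1..N}"
    then obtain p where p: "p > z" "p^2 dvd n" "n \<in> {1..N}" by auto
    have "p \<le> p^2" by (simp add: power2_eq_square)
    also have "p^2 \<le> N" using p dvd_imp_le[of "p^2" n] by auto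
    finally show "n \<in> (\<Union>d\<in>{Suc z..N}. {n \<in> {1..N}. d^2 dvd n})" using p by auto
  qed
  then have "card ({n. \<exists>p>z. p^2 dvd n} \<inter> {1..N}) \<le> card (\<Union>d\<in>{Suc z..N}. {n \<in> {1..N}. d^2 dvd n})"
    by (intro card_mono) auto
  also have "\<dots> \<le> (\<Sum>d=Suc z..N. card {n \<in> {1..N}. d^2 dvd n})" by (rule card_UN_le) auto
  also have "\<dots> = (\<Sum>d=Suc z..N. N div d^2)" by (intro sum.cong card_multiples) auto
  finally have "real (card ({n. \<exists>p>z. p^2 dvd n} \<inter> {1..N})) \<le> (\<Sum>d=Suc z..N. real (N div d^2))"
    by (simp flip: of_nat_sum)
  also have "\<dots> \<le> (\<Sum>d=Suc z..N. real N * (1 / (real d)\<^sup>2))"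
  proof (rule sum_mono)
    fix d
    show "real (N div d^2) \<le> real N * (1 / (real d)\<^sup>2)"
      using of_nat_div_le_of_nat[of N "d^2", where ?'a = real] by simp
  qed
  also have "\<dots> = real N * (\<Sum>d=Suc z..N. 1 / (real d)\<^sup>2)" by (simp only: sum_distrib_left)
  also have "\<dots> \<le> real N * (1 / real z)"
    by (intro mult_left_mono sum_inverse_squares_tail assms) auto
  finally show "real (card ({n. \<exists>p>z. p^2 dvd n} \<inter> {1..N})) \<le> 1 / real z * real N + 0" by simp
qed

text \<open>Markov's inequality: counting all integers \<open>d > y\<close> in place of primes, the
  mean of the tail is at most the sum of \<open>1 / d ^ 2\<close>, hence at most
  \<open>1 / y\<close>.\<close>

lemma sparse_large_prime_reciprocal_tail:
  assumes y: "y > 0" and \<theta>: "\<theta> > 0"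
  shows "sparse {n. \<theta> \<le> (\<Sum>p | p \<in> prime_factors n \<and> y < p. 1 / real p)} (1 / (\<theta> * real y))"
proof (rule sparseI)
  fix N :: nat
  define t where "t n = (\<Sum>p | p \<in> prime_factors n \<and> y < p. 1 / real p)" for n
  define Z where "Z = {n. \<theta> \<le> t n} \<inter> {1..N}"
  have t0: "t n \<ge> 0" for n by (simp add: t_def sum_nonneg)
  have "\<theta> * real (card Z) = (\<Sum>n\<in>Z. \<theta>)" by simp
  also have "\<dots> \<le> (\<Sum>n\<in>Z. t n)" by (intro sum_mono) (auto simp: Z_def)
  also have "\<dots> \<le> (\<Sum>n=1..N. t n)" using t0 by (intro sum_mono2) (auto simp: Z_def)
  also have "\<dots> \<le> (\<Sum>n=1..N. \<Sum>d | d \<in> {Suc y..N} \<and> d dvd n. 1 / real d)"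
  proof (rule sum_mono)
    fix n assume n: "n \<in> {1..N}"
    have "{p \<in> prime_factors n. y < p} \<subseteq> {d \<in> {Suc y..N}. d dvd n}"
      using n by (auto simp: in_prime_factors_iff dest: dvd_imp_le)
    then show "t n \<le> (\<Sum>d | d \<in> {Suc y..N} \<and> d dvd n. 1 / real d)"
      unfolding t_def by (intro sum_mono2) auto
  qed
  also have "\<dots> = (\<Sum>d=Suc y..N. \<Sum>n | n \<in> {1..N} \<and> d dvd n. 1 / real d)"
    by (rule sum.swap_restrict) auto
  also have "\<dots> \<le> (\<Sum>d=Suc y..N. real N * (1 / (real d)\<^sup>2))"
  proof (rule sum_mono)
    fix d assume d: "d \<in> {Suc y..N}"
    have "(\<Sum>n | n \<in> {1..N} \<and> d dvd n. 1 / real d) = real (N div d) * (1 / real d)"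
      using card_multiples[of d N] d by simp
    also have "\<dots> \<le> real N / real d * (1 / real d)"
      by (intro mult_right_mono of_nat_div_le_of_nat) auto
    finally show "(\<Sum>n | n \<in> {1..N} \<and> d dvd n. 1 / real d) \<le> real N * (1 / (real d)\<^sup>2)"
      by (simp add: power2_eq_square)
  qed
  also have "\<dots> = real N * (\<Sum>d=Suc y..N. 1 / (real d)\<^sup>2)" by (simp only: sum_distrib_left)
  also have "\<dots> \<le> real N * (1 / real y)"
    by (intro mult_left_mono sum_inverse_squares_tail y) auto
  finally have "real (card Z) \<le> 1 / (\<theta> * real y) * real N + 0"
    using y \<theta> by (simp add: field_simps)
  then show "real (card ({n. \<theta> \<le> (\<Sum>p | p \<in> prime_factors n \<and> y < p. 1 / real p)} \<inter> {1..N})) \<le>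
    1 / (\<theta> * real y) * real N + 0" unfolding Z_def t_def .
qed

lemma psi_ratio_upto_pos: "psi_ratio_upto y n > 0"
  unfolding psi_ratio_upto_def by (intro prod_pos) (auto intro: add_pos_nonneg)

lemma psi_ratio_upto_prime_mult:
  assumes "prime p" "\<not> p dvd m" "p \<le> y"
  shows "psi_ratio_upto y (p * m) = (1 + 1 / real p) * psi_ratio_upto y m"
proof -
  have "m \<noteq> 0" using assms(2) by (metis dvd_0_right)
  then have "{r. r \<in> prime_factors (p * m) \<and> r \<le> y} = insert p {r. r \<in> prime_factors m \<and> r \<le> y}"
    using assms by (auto simp: prime_factors_product prime_prime_factors)
  moreover have "p \<notin> {r. r \<in> prime_factors m \<and> r \<le> y}" using assms by (auto simp: in_prime_factors_iff)
  ultimately show ?thesis unfolding psi_ratio_upto_def by (simp only:) (subst prod.insert, auto)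
qed

lemma psi_ratio_le_upto_mult_exp:
  "psi_ratio n \<le> psi_ratio_upto y n * exp (\<Sum>p | p \<in> prime_factors n \<and> y < p. 1 / real p)"
proof -
  have "prime_factors n = {p \<in> prime_factors n. p \<le> y} \<union> {p \<in> prime_factors n. y < p}" by auto
  then have "psi_ratio n = (\<Prod>p\<in>{p \<in> prime_factors n. p \<le> y} \<union> {p \<in> prime_factors n. y < p}. 1 + 1 / real p)"
    unfolding psi_ratio_def by simp
  also have "\<dots> = psi_ratio_upto y n * (\<Prod>p | p \<in> prime_factors n \<and> y < p. 1 + 1 / real p)"
    unfolding psi_ratio_upto_def by (rule prod.union_disjoint) auto
  also have "\<dots> \<le> psi_ratio_upto y n * (\<Prod>p | p \<in> prime_factors n \<and> y < p. exp (1 / real p))"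
    using psi_ratio_upto_pos[of y n]
    by (intro mult_left_mono prod_mono) (auto intro: exp_ge_add_one_self add_nonneg_nonneg)
  finally show ?thesis by (simp add: exp_sum)
qed

text \<open>
  Removing a prime \<open>p \<in> F\<close> from \<open>n\<close> changes the ratio by the factor \<open>1 + 1 / p\<close>, and these
  factors are so well separated that \<open>n div p\<close> determines \<open>p\<close>.
\<close>

lemma sparse_psi_ratio_near_2:
  assumes F: "\<And>p. p \<in> F \<Longrightarrow> prime p \<and> z < p \<and> p \<le> y" and z: "z > 0"
    and sep: "\<And>p r. p \<in> F \<Longrightarrow> r \<in> F \<Longrightarrow> p < r \<Longrightarrow> (1 + \<eta>) * (1 + 1 / real r) \<le> 1 + 1 / real p"
  shows "sparse {n. 2 < (1 + \<eta>) * psi_ratio_upto y n \<and> psi_ratio_upto y n \<le> 2 \<and>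
    (\<exists>p\<in>F. p dvd n \<and> \<not> p^2 dvd n)} (1 / real z)" (is "sparse ?S _")
proof (rule sparseI)
  fix N :: nat
  define P where "P n = (SOME p. p \<in> F \<and> p dvd n \<and> \<not> p^2 dvd n)" for n
  have P: "P n \<in> F \<and> P n dvd n \<and> \<not> (P n)^2 dvd n" if "n \<in> ?S" for n
  proof -
    have "\<exists>p. p \<in> F \<and> p dvd n \<and> \<not> p^2 dvd n" using that by blast
    then show ?thesis unfolding P_def by (rule someI_ex)
  qed
  define f where "f n = n div P n" for n
  have f: "n = P n * f n" "\<not> P n dvd f n" if "n \<in> ?S" for n
  proof -
    show n: "n = P n * f n" using P[OF that] by (simp add: f_def)
    show "\<not> P n dvd f n"
    proof
      assume "P n dvd f n"
      then have "P n * P n dvd P n * f n" by (rule mult_dvd_mono[OF dvd_refl])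
      with n P[OF that] show False by (simp add: power2_eq_square)
    qed
  qed
  have ratio: "psi_ratio_upto y n = (1 + 1 / real (P n)) * psi_ratio_upto y (f n)" if "n \<in> ?S" for n
    using psi_ratio_upto_prime_mult[of "P n" "f n" y] f[OF that] P[OF that] F by metis
  \<comment> \<open>With equal cofactors, the smaller removed prime gives a ratio larger by at least
    \<open>1 + \<eta>\<close>, so both ratios cannot lie above \<open>2 / (1 + \<eta>)\<close> and
    at most 2.\<close>
  have not_less: "\<not> P n < P n'" if n: "n \<in> ?S" and n': "n' \<in> ?S" and eq: "f n = f n'" for n n'
  proof
    assume less: "P n < P n'"
    have "2 < (1 + \<eta>) * psi_ratio_upto y n'" using n' by simp
    also have "\<dots> = ((1 + \<eta>) * (1 + 1 / real (P n'))) * psi_ratio_upto y (f n)"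
      using ratio[OF n'] eq by simp
    also have "\<dots> \<le> (1 + 1 / real (P n)) * psi_ratio_upto y (f n)"
      using sep[of "P n" "P n'"] P[OF n] P[OF n'] less psi_ratio_upto_pos[of y "f n"]
      by (intro mult_right_mono) auto
    also have "\<dots> = psi_ratio_upto y n" using ratio[OF n] by simp
    also have "\<dots> \<le> 2" using n by simp
    finally show False by simp
  qed
  have inj: "inj_on f (?S \<inter> {1..N})"
  proof (rule inj_onI)
    fix n n' assume *: "n \<in> ?S \<inter> {1..N}" "n' \<in> ?S \<inter> {1..N}" "f n = f n'"
    have n: "n \<in> ?S" "n' \<in> ?S" using *(1,2) by blast+
    have "P n = P n'" using not_less[OF n *(3)] not_less[OF n(2,1) *(3)[symmetric]] by linarith
    have "n = P n * f n" by (rule f(1)[OF n(1)])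
    also have "\<dots> = P n' * f n'" using \<open>P n = P n'\<close> *(3) by simp
    also have "\<dots> = n'" by (rule f(1)[OF n(2), symmetric])
    finally show "n = n'" .
  qed
  \<comment> \<open>Removing a prime larger than \<open>z\<close> lands below
    \<open>N div z\<close>; with injectivity this is the density bound.\<close>
  have "f ` (?S \<inter> {1..N}) \<subseteq> {1..N div z}"
  proof
    fix m assume "m \<in> f ` (?S \<inter> {1..N})"
    then obtain n where n: "n \<in> ?S" "n \<in> {1..N}" "m = f n" by blast
    have "z < P n" using F P[OF n(1)] by blast
    then have "z * m \<le> P n * f n" using n(3) by (intro mult_mono) auto
    also have "\<dots> = n" by (rule f(1)[OF n(1), symmetric])
    also have "\<dots> \<le> N" using n(2) by simp
    finally have "m \<le> N div z" using z by (simp add: less_eq_div_iff_mult_less_eq mult.commute)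
    moreover have "f n \<noteq> 0" using f(1)[OF n(1)] n(2) by (metis atLeastAtMost_iff mult_0_right not_one_le_zero)
    ultimately show "m \<in> {1..N div z}" using n(3) by simp
  qed
  then have "card (f ` (?S \<inter> {1..N})) \<le> card {1..N div z}" by (intro card_mono) auto
  then have "card (?S \<inter> {1..N}) \<le> N div z" by (simp only: card_image[OF inj]) simp
  then have "real (card (?S \<inter> {1..N})) \<le> real (N div z)" by (simp only: of_nat_le_iff)
  also have "\<dots> \<le> real N / real z" by (rule of_nat_div_le_of_nat)
  finally show "real (card (?S \<inter> {1..N})) \<le> 1 / real z * real N + 0" by simp
qed

text \<open>Four exceptional sets of density at most \<open>e / 4\<close> each. The order of choice
  matters: \<open>z\<close>, then the finite set \<open>F\<close>, then the gap
  \<open>\<eta>\<close> between its factors, and only then \<open>y\<close>, so large that the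
  primes beyond it rarely change the ratio by \<open>1 + \<eta>\<close>.\<close>

lemma sparse_psi_ratio_crossing_2:
  assumes e: "e > 0"
  shows "\<exists>y. sparse {n. psi_ratio_upto y n \<le> 2 \<and> 2 \<le> psi_ratio n} e"
proof -
  define z where "z = nat \<lceil>4 / e\<rceil>"
  have ze: "4 / e \<le> real z" unfolding z_def by (rule real_nat_ceiling_ge)
  have "0 < 4 / e" using e by simp
  then have z: "z > 0" using ze by (metis of_nat_0_less_iff less_le_trans)
  have z': "1 / real z \<le> e / 4" using ze e z by (simp add: field_simps)
  obtain F where F: "finite F" "\<And>p. p \<in> F \<Longrightarrow> prime p \<and> z < p" "4 / e \<le> (\<Sum>p\<in>F. 1 / real p)"
    \<comment> \<open>The class 1 modulo 2 consists of the odd primes, so this is plain divergence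
      of the prime reciprocals.\<close>
    using sum_prime_reciprocals_progression_unbounded[of 2 1 z "4 / e"] by auto
  define w where "w = Max (insert 1 F)"
  have w: "w \<ge> 1" "\<And>p. p \<in> F \<Longrightarrow> p \<le> w" using F(1) by (auto simp: w_def)
  \<comment> \<open>For \<open>p < r \<le> w\<close> the gap \<open>1 / p - 1 / r\<close> is at
    least \<open>1 / w ^ 2\<close>, while
    \<open>\<eta> * (1 + 1 / r) \<le> 2 * \<eta>\<close>.\<close>
  define \<eta> where "\<eta> = 1 / (2 * (real w)\<^sup>2)"
  have \<eta>: "\<eta> > 0" using w by (simp add: \<eta>_def)
  have sep: "(1 + \<eta>) * (1 + 1 / real r) \<le> 1 + 1 / real p" if "p \<in> F" "r \<in> F" "p < r" for p r
  proof -
    have pr: "0 < p" "p < r" "r \<le> w" using F(2)[OF that(1)] that w by auto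
    have "\<eta> * (1 + 1 / real r) \<le> \<eta> * 2" using pr \<eta> by (intro mult_left_mono) auto
    also have "\<dots> = 1 / (real w * real w)" by (simp add: \<eta>_def power2_eq_square)
    also have "\<dots> \<le> 1 / (real p * real r)"
      using pr by (intro divide_left_mono mult_mono mult_pos_pos) auto
    also have "\<dots> \<le> (real r - real p) / (real p * real r)"
      using pr by (intro divide_right_mono) auto
    also have "\<dots> = 1 / real p - 1 / real r" using pr by (simp add: field_simps)
    finally show ?thesis by (simp add: distrib_left distrib_right add_divide_distrib)
  qed
  define \<theta> where "\<theta> = ln (1 + \<eta>)"
  have \<theta>: "\<theta> > 0" using \<eta> by (simp add: \<theta>_def)
  define y where "y = max w (nat \<lceil>4 / (e * \<theta>)\<rceil>)"
  have y: "y \<ge> w" "y > 0" using w by (auto simp: y_def)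
  have "4 / (e * \<theta>) \<le> real y" unfolding y_def by (metis max.cobounded2 of_nat_le_iff order_trans real_nat_ceiling_ge)
  then have y': "1 / (\<theta> * real y) \<le> e / 4" using e \<theta> y by (simp add: field_simps)
  define A where "A = (\<Sum>p\<in>F. 1 / real p)"
  have A: "A \<ge> 4 / e" "A > 0" using F(3) \<open>0 < 4 / e\<close> unfolding A_def by linarith+
  have A': "1 / A \<le> e / 4" using A e by (simp add: field_simps)
  let ?S1 = "{n. 2 < (1 + \<eta>) * psi_ratio_upto y n \<and> psi_ratio_upto y n \<le> 2 \<and> (\<exists>p\<in>F. p dvd n \<and> \<not> p^2 dvd n)}"
  let ?S2 = "{n::nat. \<exists>p>z. p^2 dvd n}"
  let ?S3 = "{n. \<forall>p\<in>F. \<not> p dvd n}"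
  let ?S4 = "{n. \<theta> \<le> (\<Sum>p | p \<in> prime_factors n \<and> y < p. 1 / real p)}"
  have "sparse ?S1 (1 / real z)"
    using sparse_psi_ratio_near_2[of F z y \<eta>] F w y z sep by (meson order_trans)
  moreover have "sparse ?S2 (1 / real z)" by (rule sparse_square_divisor[OF z])
  moreover have "sparse ?S3 (1 / A)"
    using sparse_no_prime_divisor_in[OF F(1) _ A_def A(2)] F(2) by blast
  moreover have "sparse ?S4 (1 / (\<theta> * real y))" by (rule sparse_large_prime_reciprocal_tail[OF y(2) \<theta>])
  ultimately have "sparse (?S1 \<union> (?S2 \<union> (?S3 \<union> ?S4))) (1 / real z + (1 / real z + (1 / A + 1 / (\<theta> * real y))))"
    by (intro sparse_Un)
  then have "sparse {n. psi_ratio_upto y n \<le> 2 \<and> 2 \<le> psi_ratio n} e"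
  proof (rule sparse_mono)
    show "1 / real z + (1 / real z + (1 / A + 1 / (\<theta> * real y))) \<le> e" using z' y' A' by linarith
    show "{n. psi_ratio_upto y n \<le> 2 \<and> 2 \<le> psi_ratio n} \<inter> {1..} \<subseteq> ?S1 \<union> (?S2 \<union> (?S3 \<union> ?S4))"
    proof
      fix n assume n: "n \<in> {n. psi_ratio_upto y n \<le> 2 \<and> 2 \<le> psi_ratio n} \<inter> {1..}"
      have "2 < (1 + \<eta>) * psi_ratio_upto y n" if "n \<notin> ?S4"
      proof -
        have "2 \<le> psi_ratio_upto y n * exp (\<Sum>p | p \<in> prime_factors n \<and> y < p. 1 / real p)"
          using n psi_ratio_le_upto_mult_exp[of n y] by auto
        also have "\<dots> < psi_ratio_upto y n * exp \<theta>"
          using that psi_ratio_upto_pos[of y n] by (intro mult_strict_left_mono) auto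
        also have "\<dots> = (1 + \<eta>) * psi_ratio_upto y n" using \<eta> by (simp add: \<theta>_def)
        finally show ?thesis .
      qed
      then show "n \<in> ?S1 \<union> (?S2 \<union> (?S3 \<union> ?S4))" using n F(2) by blast
    qed
  qed
  then show ?thesis ..
qed

text \<open>Defined iterates agree with those of the total function \<open>T\<close>, so cycles can
  be counted with \<open>funpow\<close>, where an orbit that reaches 0 stays there.\<close>

lemma T_iter_eq_SomeD: "T_iter j n = Some m \<Longrightarrow> m = (T ^^ j) n"
  by (induction j arbitrary: m) (auto split: option.splits if_splits)

lemma sparse_cycle_minima:
  assumes l: "l > 0" and e: "e > 0"
  shows "sparse {n. (T ^^ l) n = n \<and> n \<le> T n} e"
proof -
  obtain y where y: "sparse {n. psi_ratio_upto y n \<le> 2 \<and> 2 \<le> psi_ratio n} (e / 2)" (is "sparse ?D _")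
    using sparse_psi_ratio_crossing_2[of "e / 2"] e by auto
  obtain E where E: "sparse E (e / 2)"
    "\<And>n j q. n \<notin> E \<Longrightarrow> j \<le> l \<Longrightarrow> q \<le> y \<Longrightarrow> prime q \<Longrightarrow> q dvd n \<Longrightarrow> q dvd (T ^^ j) n"
    using small_primes_persist[of "e / 2" l y] e by auto
  have "sparse (?D \<union> E) (e / 2 + e / 2)" by (rule sparse_Un[OF y E(1)])
  then show ?thesis
  proof (rule sparse_mono)
    show "{n. (T ^^ l) n = n \<and> n \<le> T n} \<inter> {1..} \<subseteq> ?D \<union> E"
    proof (rule subsetI, rule ccontr)
      fix n assume n: "n \<in> {n. (T ^^ l) n = n \<and> n \<le> T n} \<inter> {1..}" and nDE: "n \<notin> ?D \<union> E"
      have n0: "n > 0" and cyc: "(T ^^ l) n = n" and Tn: "n \<le> T n" using n by auto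
      have "real n * 1 \<le> real n * (psi_ratio n - 1)" using Tn by (simp flip: T_eq_psi_ratio)
      then have "2 \<le> psi_ratio n" using n0 by simp
      then have gt: "psi_ratio_upto y n > 2" using nDE by auto
      have incr: "(T ^^ j) n < (T ^^ Suc j) n" if j: "j \<le> l" and pos: "(T ^^ j) n > 0" for j
      proof -
        define m where "m = (T ^^ j) n"
        \<comment> \<open>All factors exceed 1, so the truncated ratio of \<open>n\<close> bounds
          the full ratio of every iterate \<open>m\<close> from below.\<close>
        have "{p. p \<in> prime_factors n \<and> p \<le> y} \<subseteq> prime_factors m"
          using E(2)[of n j] nDE j pos by (auto simp: in_prime_factors_iff m_def)
        then have "psi_ratio_upto y n \<le> psi_ratio m"
          unfolding psi_ratio_upto_def psi_ratio_def by (intro prod_mono2) auto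
        then have "1 < psi_ratio m - 1" using gt by simp
        then have "real m * 1 < real m * (psi_ratio m - 1)"
          using pos by (intro mult_strict_left_mono) (auto simp: m_def)
        then have "real m < real (T m)" by (simp add: T_eq_psi_ratio)
        then show ?thesis by (simp add: m_def)
      qed
      \<comment> \<open>This form also supplies the positivity that \<open>incr\<close> asks for at
        the next step.\<close>
      have "(T ^^ j) n \<ge> n + j" if "j \<le> l" for j
        using that
      proof (induction j)
        case (Suc j)
        then show ?case using incr[of j] n0 by simp
      qed simp
      from this[of l] show False using cyc l by simp
    qed
  qed simp
qed

text \<open>A point up to \<open>N\<close> on a cycle has its cycle minimum up to \<open>N\<close>
  as well and is one of at most \<open>l\<close> iterates of it, so the minima are taken with
  parameter \<open>e / l\<close>.\<close>

lemma sparse_cycles: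
  assumes l: "l > 0" and e: "e > 0"
  shows "sparse {n. n > 0 \<and> (T ^^ l) n = n} e" (is "sparse ?Cyc _")
proof -
  define M where "M = {n. (T ^^ l) n = n \<and> n \<le> T n}"
  obtain C where C: "\<And>N. real (card (M \<inter> {1..N})) \<le> e / real l * real N + C"
    using sparse_cycle_minima[of l "e / real l"] l e unfolding sparse_def M_def by auto
  have sub: "?Cyc \<inter> {1..N} \<subseteq> (\<Union>i<l. (T ^^ Suc i) ` (M \<inter> {1..N}))" for N
  proof
    fix n assume n: "n \<in> ?Cyc \<inter> {1..N}"
    then have cyc: "(T ^^ l) n = n" and n0: "n > 0" "n \<le> N" by auto
    define m where "m = (LEAST v. \<exists>j. v = (T ^^ j) n)"
    have "\<exists>j. m = (T ^^ j) n" unfolding m_def by (rule LeastI_ex) blast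
    then obtain j where "m = (T ^^ j) n" ..
    then have j: "m = (T ^^ (j mod l)) n" using cyc by (simp add: funpow_mod_eq)
    have least: "m \<le> (T ^^ i) n" for i unfolding m_def by (rule Least_le) blast
    have jl: "j mod l < l" using l by simp
    \<comment> \<open>The minimum is reached after \<open>j mod l\<close> steps; the
      \<open>Suc i\<close> steps left to complete \<open>l\<close> lead back to
      \<open>n\<close>.\<close>
    define i where "i = l - Suc (j mod l)"
    have i: "i < l" "Suc i + j mod l = l" using jl by (auto simp: i_def)
    have ret: "n = (T ^^ Suc i) m"
      unfolding j using cyc i by (metis comp_apply funpow_add)
    have "(T ^^ l) m = m"
      unfolding j using cyc by (metis comp_apply funpow_add add.commute)
    moreover have "m \<le> T m" using least[of "Suc (j mod l)"] by (simp add: j)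
    moreover have "m \<noteq> 0"
    proof
      assume "m = 0"
      then have "n = (T ^^ Suc i) 0" using ret by simp
      also have "(T ^^ k) 0 = 0" for k by (induction k) (auto simp: T_def dedekind_psi_def)
      finally show False using n0 by simp
    qed
    moreover have "m \<le> N" using least[of 0] n0 by simp
    ultimately have "m \<in> M \<inter> {1..N}" by (auto simp: M_def)
    with ret i(1) show "n \<in> (\<Union>i<l. (T ^^ Suc i) ` (M \<inter> {1..N}))" by blast
  qed
  show ?thesis
  proof (rule sparseI)
    fix N
    have "card (?Cyc \<inter> {1..N}) \<le> card (\<Union>i<l. (T ^^ Suc i) ` (M \<inter> {1..N}))"
      by (intro card_mono sub) auto
    also have "\<dots> \<le> (\<Sum>i<l. card ((T ^^ Suc i) ` (M \<inter> {1..N})))" by (rule card_UN_le) auto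
    also have "\<dots> \<le> (\<Sum>i<l. card (M \<inter> {1..N}))" by (intro sum_mono card_image_le) auto
    finally have "real (card (?Cyc \<inter> {1..N})) \<le> real l * real (card (M \<inter> {1..N}))"
      by (simp flip: of_nat_mult)
    also have "\<dots> \<le> real l * (e / real l * real N + C)" by (intro mult_left_mono C) auto
    also have "\<dots> = e * real N + real l * C" using l by (simp add: distrib_left)
    finally show "real (card (?Cyc \<inter> {1..N})) \<le> e * real N + real l * C" .
  qed
qed

lemma count_smallo_of_sparse:
  assumes "\<And>e. e > 0 \<Longrightarrow> sparse A e"
  shows "(\<lambda>x::real. real (card {n. 0 < n \<and> real n \<le> x \<and> n \<in> A})) \<in> o[at_top](\<lambda>x. x)"
proof (rule landau_o.smallI)
  fix c :: real assume c: "c > 0"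
  obtain C where C: "\<And>N. real (card (A \<inter> {1..N})) \<le> c / 2 * real N + C"
    using assms[of "c / 2"] c unfolding sparse_def by auto
  show "eventually (\<lambda>x. norm (real (card {n. 0 < n \<and> real n \<le> x \<and> n \<in> A})) \<le> c * norm x) at_top"
    \<comment> \<open>From this point on the additive constant \<open>C\<close> fits into the other
      half of \<open>c * x\<close>.\<close>
    using eventually_ge_at_top[of "max 0 (2 * C / c)"]
  proof eventually_elim
    case (elim x)
    then have x: "x \<ge> 0" "2 * C / c \<le> x" by auto
    have "{n. 0 < n \<and> real n \<le> x \<and> n \<in> A} = A \<inter> {1..nat \<lfloor>x\<rfloor>}"
      using x by (auto simp: le_nat_floor le_nat_iff le_floor_iff Suc_le_eq)
    then have "real (card {n. 0 < n \<and> real n \<le> x \<and> n \<in> A}) \<le> c / 2 * real (nat \<lfloor>x\<rfloor>) + C"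
      using C by simp
    also have "\<dots> \<le> c / 2 * x + C" using c x by (intro add_right_mono mult_left_mono) auto
    also have "\<dots> \<le> c * x" using x c by (simp add: field_simps)
    finally show ?case using x by simp
  qed
qed

theorem corollary1:
  fixes l :: nat
  assumes "l > 0"
  shows "(\<lambda>x::real. real (card {n::nat. 0 < n \<and> real n \<le> x \<and> T_iter l n = Some n})) \<in> o[at_top](\<lambda>x. x)
       \<and> has_asymptotic_density {n. periodic_point n \<and> exact_period n = l} 0"
proof
  have sparse: "sparse {n. n > 0 \<and> T_iter l n = Some n} e" if "e > 0" for e
    using sparse_cycles[OF assms that]
    by (rule sparse_mono) (auto dest!: T_iter_eq_SomeD[of l])
  then show "(\<lambda>x::real. real (card {n. 0 < n \<and> real n \<le> x \<and> T_iter l n = Some n})) \<in> o[at_top](\<lambda>x. x)"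
    using count_smallo_of_sparse[of "{n. n > 0 \<and> T_iter l n = Some n}"] by (simp cong: conj_cong)
  have "T_iter l n = Some n" if "periodic_point n" "exact_period n = l" for n
  proof -
    have "\<exists>r. r > 0 \<and> T_iter r n = Some n" using that by (auto simp: periodic_point_def)
    then have "exact_period n > 0 \<and> T_iter (exact_period n) n = Some n"
      unfolding exact_period_def by (rule LeastI_ex)
    then show ?thesis using that by simp
  qed
  then have "sparse {n. periodic_point n \<and> exact_period n = l} e" if "e > 0" for e
    using sparse[OF that] by (rule_tac sparse_mono) auto
  then show "has_asymptotic_density {n. periodic_point n \<and> exact_period n = l} 0"
    unfolding has_asymptotic_density_def by (intro smalloD_tendsto count_smallo_of_sparse)
qed

end
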